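(* Let $d\geqslant 3$ and $n$ be positive integers with $n\equiv -1\pmod{d}$. Then $$\sum_{k=0}^{M}[2dk+1]\frac{(q;q^d)_k^{2d}}{(q^d;q^d)_k^{2d}}\,q^{d(d-2)k}\equiv 0\pmod{[n]\Phi_n(q)^3}$$ holds both for $M=((d-1)n-1)/d$ and for $M=n-1$.
   Context: Here $q$ is an indeterminate. The $q$-shifted factorial is $(a;q)_k=(1-a)(1-aq)\cdots(1-aq^{k-1})$, with $(a;q)_0=1$; thus $(q;q^d)_k=\prod_{j=0}^{k-1}(1-q^{1+dj})$. The $q$-integer is $[m]=[m]_q=1+q+\cdots+q^{m-1}=\frac{1-q^m}{1-q}$. $\Phi_n(q)=\prod_{1\leqslant k\leqslant n,\ \gcd(n,k)=1}(q-\zeta^k)$, with $\zeta$ a primitive $n$-th root of unity, is the $n$-th cyclotomic polynomial. For rational functions $A(q),B(q)\in\mathbb{Q}(q)$ and a polynomial $P(q)$, the congruence $A(q)\equiv B(q)\pmod{P(q)}$ means that $P(q)$ divides the numerator of $A(q)-B(q)$ written in lowest terms, as polynomials in $q$ over $\mathbb{Q}$. *)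

theory Defs
  imports
    "HOL-Computational_Algebra.Computational_Algebra"
    "HOL-Computational_Algebra.Field_as_Ring"
    "HOL-Number_Theory.Cong"
    "HOL-Number_Theory.Totient"
    Complex_Main
begin

definition qpochhammer :: "'a::comm_ring_1 \<Rightarrow> 'a \<Rightarrow> nat \<Rightarrow> 'a" where
  "qpochhammer a q k = (\<Prod>j<k. 1 - a * q ^ j)"

definition qint :: "'a::comm_ring_1 \<Rightarrow> nat \<Rightarrow> 'a" where
  "qint q m = (\<Sum>j<m. q ^ j)"

lemma qint_eq_quotient: "q \<noteq> 1 \<Longrightarrow> qint q m = (1 - q ^ m) / (1 - q)"
  for q :: "'a::field"
  unfolding qint_def by (rule sum_gp_strict[THEN trans]) simp

text \<open>The field \<open>\<rat>(q)\<close> is the fraction field of \<open>\<rat>[q]\<close>. The indeterminate appears both as a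
  polynomial and as a rational function.\<close>

abbreviation q_poly :: "rat poly" where
  "q_poly \<equiv> [:0, 1:]"

definition q_rat :: "rat poly fract" where
  "q_rat = Fract q_poly 1"

text \<open>The cyclotomic polynomial is defined by its complex roots. Its coefficients are rational
  (lemma \<open>map_poly_cyclotomic\<close> below), so the description in \<open>cyclotomic\<close> is proper for \<open>n > 0\<close>.\<close>

definition cyclotomic_complex :: "nat \<Rightarrow> complex poly" where
  "cyclotomic_complex n =
     (\<Prod>k \<in> {k \<in> {1..n}. coprime n k}. [:- (cis (2 * pi / real n) ^ k), 1:])"

definition cyclotomic :: "nat \<Rightarrow> rat poly" where
  "cyclotomic n = (THE p. map_poly of_rat p = cyclotomic_complex n)"

text \<open>\<open>quot_of_fract\<close> returns numerator and denominator in lowest terms (with monic denominator).\<close>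

definition ratfun_cong :: "rat poly fract \<Rightarrow> rat poly fract \<Rightarrow> rat poly \<Rightarrow> bool" where
  "ratfun_cong A B P \<longleftrightarrow> P dvd fst (quot_of_fract (A - B))"

lemma map_poly_of_rat_mult:
  "map_poly of_rat (p * r) = map_poly of_rat p * (map_poly of_rat r :: complex poly)"
  by (intro poly_eqI) (simp add: coeff_map_poly coeff_mult of_rat_sum of_rat_mult)

lemma map_poly_of_rat_add:
  "map_poly of_rat (p + r) = map_poly of_rat p + (map_poly of_rat r :: complex poly)"
  by (intro poly_eqI) (simp add: coeff_map_poly of_rat_add)

lemma map_poly_of_rat_diff:
  "map_poly of_rat (p - r) = map_poly of_rat p - (map_poly of_rat r :: complex poly)"
  by (intro poly_eqI) (simp add: coeff_map_poly of_rat_diff)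

lemma map_poly_of_rat_prod:
  "map_poly of_rat (\<Prod>x\<in>A. f x) = (\<Prod>x\<in>A. (map_poly of_rat (f x) :: complex poly))"
  by (induction A rule: infinite_finite_induct) (simp_all add: map_poly_of_rat_mult)

lemma degree_map_poly_of_rat: "degree (map_poly of_rat p :: complex poly) = degree p"
  by (rule degree_map_poly) simp

lemma inj_map_poly_of_rat: "inj (map_poly of_rat :: rat poly \<Rightarrow> complex poly)"
  by (rule injI) (simp add: poly_eq_iff coeff_map_poly)

lemma linear_factor_prod:
  assumes "n > 0"
  shows "(\<Prod>k\<in>{0<..n}. [:- (cis (2 * pi / real n) ^ k), 1:]) = monom 1 n - 1"
proof -
  let ?z = "cis (2 * pi / real n)"
  let ?P = "\<Prod>k\<in>{0<..n}. [:- (?z ^ k), 1:]"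
  have deg: "degree ?P = n"
    by (subst degree_prod_eq_sum_degree) auto
  have lc: "lead_coeff ?P = 1"
    by (simp add: lead_coeff_prod)
  have zn: "?z ^ n = 1"
    using assms by (simp add: DeMoivre)
  have bij: "bij_betw (\<lambda>k. cis (2 * pi * real k / real n)) {..<n} {z. z ^ n = 1}"
    using assms by (rule bij_betw_roots_unity)
  show ?thesis
  proof (rule poly_eqI_degree_lead_coeff[where n = n and A = "{z. z ^ n = 1}"])
    show "coeff ?P n = coeff (monom 1 n - 1) n"
      using lc deg assms by simp
    show "n \<le> card {z::complex. z ^ n = 1}"
      using assms by (simp add: card_roots_unity_eq)
    show "degree ?P \<le> n" using deg by simp
    show "degree (monom 1 n - 1 :: complex poly) \<le> n"
      by (intro degree_diff_le degree_monom_le) simp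
  next
    fix w :: complex assume "w \<in> {z. z ^ n = 1}"
    then obtain k where k: "k < n" "w = cis (2 * pi * real k / real n)"
      using bij by (auto simp: bij_betw_def)
    then have w: "w = ?z ^ k" by (simp add: DeMoivre mult_ac)
    have "\<exists>j\<in>{0<..n}. w = ?z ^ j"
    proof (cases "k = 0")
      case True
      then show ?thesis using w zn assms by (intro bexI[of _ n]) auto
    next
      case False
      then show ?thesis using w k by (intro bexI[of _ k]) auto
    qed
    then have "poly ?P w = 0" by (auto simp: poly_prod)
    moreover have "w ^ n = 1" using \<open>w \<in> _\<close> by simp
    ultimately show "poly ?P w = poly (monom 1 n - 1) w"
      by (simp add: poly_monom)
  qed
qed

lemma cyclotomic_complex_totatives:
  "cyclotomic_complex n = (\<Prod>k\<in>totatives n. [:- (cis (2 * pi / real n) ^ k), 1:])"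
  unfolding cyclotomic_complex_def totatives_def
  by (rule prod.cong) (auto simp: coprime_commute)

lemma prod_cyclotomic_complex:
  assumes "n > 0"
  shows "(\<Prod>d | d dvd n. cyclotomic_complex d) = monom 1 n - 1"
proof -
  let ?f = "\<lambda>k. [:- (cis (2 * pi / real n) ^ k), 1:]"
  have "monom 1 n - 1 = prod ?f {0<..n}"
    by (rule linear_factor_prod[OF assms, symmetric])
  also have "\<dots> = (\<Prod>d | d dvd n. prod ?f {k. k \<in> {0<..n} \<and> gcd k n = d})"
    using assms by (intro prod.group[symmetric]) auto
  also have "\<dots> = (\<Prod>d | d dvd n. cyclotomic_complex (n div d))"
  proof (rule prod.cong)
    fix d assume "d \<in> {d. d dvd n}"
    then have d: "d dvd n" "d > 0" using assms by (auto intro: Nat.gr0I)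
    have "prod ?f {k. k \<in> {0<..n} \<and> gcd k n = d} = (\<Prod>k\<in>totatives (n div d). ?f (k * d))"
      using bij_betw_totatives_gcd_eq[OF d(1) assms]
      by (intro prod.reindex_bij_betw[symmetric])
    also have "\<dots> = cyclotomic_complex (n div d)"
      unfolding cyclotomic_complex_totatives
      using d assms by (intro prod.cong) (auto simp: DeMoivre real_of_nat_div mult_ac)
    finally show "prod ?f {k. k \<in> {0<..n} \<and> gcd k n = d} = cyclotomic_complex (n div d)" .
  qed simp
  also have "\<dots> = (\<Prod>d | d dvd n. cyclotomic_complex d)"
    by (rule prod.reindex_bij_witness[where i = "\<lambda>d. n div d" and j = "\<lambda>d. n div d"])
       (use assms in auto)
  finally show ?thesis by simp
qed

lemma cyclotomic_complex_rational:
  "n > 0 \<Longrightarrow> \<exists>p. map_poly of_rat p = cyclotomic_complex n"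
proof (induction n rule: less_induct)
  case (less n)
  let ?D = "{d. d dvd n} - {n}"
  have "\<forall>d\<in>?D. \<exists>p. map_poly of_rat p = cyclotomic_complex d"
  proof
    fix d assume "d \<in> ?D"
    then have "d dvd n" "d \<noteq> n" by auto
    with less.prems have "d < n" "d > 0"
      using dvd_imp_le[of d n] by (auto simp: dvd_pos_nat)
    then show "\<exists>p. map_poly of_rat p = cyclotomic_complex d" by (rule less.IH)
  qed
  then obtain f where f: "\<And>d. d \<in> ?D \<Longrightarrow> map_poly of_rat (f d) = cyclotomic_complex d"
    by metis
  define P where "P = (\<Prod>d\<in>?D. f d)"
  let ?h = "map_poly of_rat :: rat poly \<Rightarrow> complex poly"
  have hP: "?h P = (\<Prod>d\<in>?D. cyclotomic_complex d)"
    unfolding P_def map_poly_of_rat_prod by (rule prod.cong) (use f in auto)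
  have "monom 1 n - 1 = cyclotomic_complex n * (\<Prod>d\<in>?D. cyclotomic_complex d)"
    using less.prems prod.remove[of "{d. d dvd n}" n cyclotomic_complex]
    by (simp add: prod_cyclotomic_complex)
  then have eq: "?h (monom 1 n - 1) = cyclotomic_complex n * ?h P"
    by (simp add: hP map_poly_of_rat_diff map_poly_monom)
  define S R where "S = (monom 1 n - 1) div P" and "R = (monom 1 n - 1) mod P"
  have "monom 1 n - 1 = S * P + R" by (simp add: S_def R_def)
  then have R: "?h R = (cyclotomic_complex n - ?h S) * ?h P"
    using eq by (simp add: map_poly_of_rat_add map_poly_of_rat_mult algebra_simps)
  have P0: "?h P \<noteq> 0"
    unfolding hP cyclotomic_complex_def using less.prems by auto
  then have "P \<noteq> 0" by auto
  then have Rdeg: "R = 0 \<or> degree R < degree P"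
    unfolding R_def by (rule degree_mod_less)
  have "cyclotomic_complex n - ?h S = 0"
  proof (rule ccontr)
    assume nz: "cyclotomic_complex n - ?h S \<noteq> 0"
    then have "degree (?h R) \<ge> degree (?h P)" "?h R \<noteq> 0"
      using P0 by (simp_all add: R degree_mult_eq)
    then show False using Rdeg by (auto simp: degree_map_poly_of_rat)
  qed
  then show ?case by (intro exI[of _ S]) simp
qed

lemma map_poly_cyclotomic:
  assumes "n > 0"
  shows "map_poly of_rat (cyclotomic n) = cyclotomic_complex n"
proof -
  obtain p where p: "map_poly of_rat p = cyclotomic_complex n"
    using cyclotomic_complex_rational[OF assms] by blast
  show ?thesis
    unfolding cyclotomic_def
    by (rule theI[of _ p]) (use p injD[OF inj_map_poly_of_rat] in auto)
qed

end

theory Submission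
  imports Defs
begin

text \<open>
  Put \<open>Q = q^d\<close>, \<open>n + 1 = d r\<close> and \<open>M = (d - 1) r - 1\<close>, so that \<open>d M + 1 = (d - 1) n\<close>. The modulus
  \<open>[n] \<Phi>_n(q)^3\<close> has a zero of order 4 at every primitive \<open>n\<close>-th root of unity and a simple zero at
  every other \<open>n\<close>-th root of unity except 1, so the claim is about the order of vanishing of the
  sum at each such root \<open>z\<close>. This order is measured by substituting \<open>q = z e^t\<close>, which turns
  the sum into a power series in \<open>t\<close> (\<open>evaluates_to\<close>, \<open>order_numerator_ge\<close>).

  Primitive \<open>z\<close>. Replace the 2d equal factors of a summand by
  \<open>\<psi>_k(c) = (\<Prod>i<k. 1 - q Q^i c) (\<Prod>k<i\<le>M. c - Q^i)\<close> with parameters \<open>c_1, ..., c_2d\<close>: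
  the sum of \<open>(1 - q Q^(2k)) Q^((d-2)k) \<psi>_k(c_1) ... \<psi>_k(c_2d)\<close> is, when all \<open>c_j = 1\<close>,
  the original sum with upper limit \<open>M\<close> times a unit. Two facts are used.

  (1) The deformed sum is 0 when \<open>c_1 = q^(-(d-1)n)\<close>, \<open>c_2 = 1\<close> and the other parameters form
  \<open>d - 1\<close> pairs with product \<open>q^n\<close> (\<open>vanishing_sum\<close>). The first two factors are the weights of
  a divided difference at the nodes \<open>Q^(-k) + q Q^k\<close>, \<open>k = 0, ..., M\<close>, and, because
  \<open>q^(n+1)\<close> is the integral power \<open>Q^r\<close>, every pair contributes a polynomial of degree \<open>r - 1\<close> in
  the node; the total degree \<open>(d - 1)(r - 1)\<close> is below \<open>M\<close>.

  (2) At \<open>t = 0\<close> the summands are odd under \<open>k \<mapsto> M - k\<close>, identically in the parameters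
  (\<open>antisymmetric_sum\<close>).

  Now let \<open>c_j = e^(n v_j t)\<close> with \<open>v\<close> consisting of \<open>1 - d\<close>, 0 and \<open>d - 1\<close> copies of the pair
  \<open>u, 1 - u\<close>, so that (1) applies. The entries of \<open>v\<close> have sum 0, and the complex number \<open>u\<close> can be
  chosen such that their squares have sum 0 as well. As \<open>log \<psi>_k(e^x)\<close> is a power series in \<open>x\<close>, the
  deformed summand then differs from the undeformed one only by a term in \<open>t^3\<close>, up to \<open>O(t^4)\<close>
  (\<open>cubic_cancellation\<close>). By (2) the coefficients of \<open>t^3\<close> in these differences add up to 0. Hence
  the undeformed sum agrees with the deformed sum, which is 0, up to \<open>O(t^4)\<close>
  (\<open>fourth_order_vanishing\<close>).

  Other \<open>z\<close>. If \<open>z\<close> has order \<open>m < n\<close>, then modulo \<open>t\<close> the summand at \<open>j m + i\<close> is a constant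
  depending on \<open>j\<close> times the summand at \<open>i\<close> (\<open>summand_block\<close>), and (2), applied with the index
  \<open>s < m\<close> at which the numerator first vanishes, kills each block (\<open>block_vanishes\<close>).
\<close>

section \<open>A vanishing well-poised sum\<close>

text \<open>The sum is the coefficient of \<open>X^M\<close> in the Lagrange interpolation polynomial of \<open>p\<close> at the
  \<open>M + 1\<close> nodes, which is \<open>p\<close> itself.\<close>

lemma sum_divided_differences_eq_0:
  fixes x :: "nat \<Rightarrow> 'a::field"
  assumes inj: "inj_on x {..M}" and deg: "degree p < M"
  shows "(\<Sum>k\<le>M. poly p (x k) / (\<Prod>j\<in>{..M} - {k}. x k - x j)) = 0"
proof -
  define D where "D k = (\<Prod>j\<in>{..M} - {k}. x k - x j)" for k
  define N where "N k = (\<Prod>j\<in>{..M} - {k}. [:- x j, 1:])" for k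
  define L where "L = (\<Sum>k\<le>M. smult (poly p (x k) / D k) (N k))"
  have D0: "D k \<noteq> 0" if "k \<le> M" for k
    using inj that by (auto simp: D_def inj_on_def)
  have degN: "degree (N k) = M" if "k \<le> M" for k
    using that unfolding N_def by (subst degree_prod_eq_sum_degree) auto
  have lcN: "coeff (N k) M = 1" if "k \<le> M" for k
    using lead_coeff_prod[of "\<lambda>j. [:- x j, 1:]" "{..M} - {k}"] degN[OF that]
    by (simp add: N_def)
  have polyN: "poly (N k) (x i) = (if i = k then D k else 0)" if "k \<le> M" "i \<le> M" for i k
    using that by (auto simp: N_def D_def poly_prod)
  have "p = L"
  proof (rule poly_eqI_degree[where A = "x ` {..M}"])
    fix y assume "y \<in> x ` {..M}"
    then obtain i where i: "i \<le> M" "y = x i" by auto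
    have "poly L y = (\<Sum>k\<le>M. if k = i then poly p (x i) else 0)"
      unfolding L_def poly_sum by (intro sum.cong refl) (use i D0 in \<open>auto simp: polyN\<close>)
    then show "poly p y = poly L y" using i by simp
  next
    have c: "card (x ` {..M}) = Suc M" using card_image[OF inj] by simp
    have "degree L \<le> M"
      unfolding L_def by (intro degree_sum_le) (auto intro!: order.trans[OF degree_smult_le] simp: degN)
    then show "degree p < card (x ` {..M})" "degree L < card (x ` {..M})" using deg c by auto
  qed
  then have "0 = coeff L M" using deg by (simp add: coeff_eq_0)
  also have "\<dots> = (\<Sum>k\<le>M. poly p (x k) / D k)"
    unfolding L_def coeff_sum by (intro sum.cong) (simp_all add: lcN)
  finally show ?thesis by (simp add: D_def)
qed

text \<open>The quotient \<open>(q c; Q)_k / (Q / c; Q)_k\<close> of a well-poised series with base parameter \<open>q\<close>,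
  multiplied by \<open>(Q / c; Q)_M c^(M - k)\<close> to make it a polynomial in \<open>c\<close>.\<close>

definition term_poly :: "'a::comm_ring_1 \<Rightarrow> 'a \<Rightarrow> nat \<Rightarrow> nat \<Rightarrow> 'a poly" where
  "term_poly q Q M k = (\<Prod>i<k. [:1, - (q * Q ^ i):]) * (\<Prod>i\<in>{k<..M}. [:- (Q ^ i), 1:])"

lemma poly_term_poly:
  "poly (term_poly q Q M k) c = (\<Prod>i<k. 1 - q * Q ^ i * c) * (\<Prod>i\<in>{k<..M}. c - Q ^ i)"
  by (simp add: term_poly_def poly_prod algebra_simps)

lemma poly_term_poly_Suc:
  assumes "k < M"
  shows "poly (term_poly q Q M (Suc k)) c * (c - Q ^ Suc k) = poly (term_poly q Q M k) c * (1 - q * Q ^ k * c)"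
proof -
  have "{k<..M} = insert (Suc k) {Suc k<..M}" using assms by auto
  then show ?thesis unfolding poly_term_poly by simp
qed

locale well_poised =
  fixes q Q :: "'a::field" and M :: nat
  assumes q0: "q \<noteq> 0" and Q0: "Q \<noteq> 0"
    and Q_power: "\<And>i. 0 < i \<Longrightarrow> Q ^ i \<noteq> 1" and qQ_power: "\<And>i. q * Q ^ i \<noteq> 1"
begin

definition node :: "nat \<Rightarrow> 'a" where
  "node k = inverse Q ^ k + q * Q ^ k"

lemma inverse_power_mult [simp]: "Q ^ k * inverse Q ^ k = 1" "inverse Q ^ k * Q ^ k = 1"
  using Q0 by (simp_all add: power_inverse)

lemma node_diff: 
  assumes "j \<le> k"
  shows "node k - node j = inverse Q ^ k * (1 - Q ^ (k - j)) * (1 - q * Q ^ (j + k))"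
proof -
  obtain i where k: "k = j + i" using assms by (metis le_Suc_ex)
  show ?thesis using Q0 by (simp add: k node_def power_add field_simps)
qed

lemma inj_node: "inj node"
proof (rule linorder_injI)
  fix j k :: nat assume "j < k"
  then have "node k - node j \<noteq> 0"
    unfolding node_diff[OF less_imp_le[OF \<open>j < k\<close>]] using Q0 Q_power[of "k - j"] qQ_power[of "j + k"] by auto
  then show "node j \<noteq> node k" by auto
qed

text \<open>With \<open>c = Q^(-M) / q\<close> the numerator becomes \<open>(Q^(-M); Q)_k\<close>. Together with the factor at
  \<open>c = 1\<close> this is, up to the geometric factor \<open>q^k\<close>, the reciprocal of the product of the
  differences of the nodes: all the \<open>q\<close>-factorials recombine into \<open>P M\<close> and \<open>R (2 * M + 1)\<close>, which
  do not depend on \<open>k\<close>.\<close>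

lemma terminating_factor:
  assumes "k \<le> M"
  shows "(1 - q * Q ^ (2 * k)) * poly (term_poly q Q M k) (inverse Q ^ M / q) * poly (term_poly q Q M k) 1
    * (\<Prod>j\<in>{..M} - {k}. node k - node j) =
    q ^ k * (poly (term_poly q Q M 0) (inverse Q ^ M / q) * poly (term_poly q Q M 0) 1
      * (1 - q) * (\<Prod>j\<in>{..M} - {0}. node 0 - node j))"
proof -
  define P where "P m = (\<Prod>i<m. 1 - Q ^ Suc i)" for m
  define R where "R m = (\<Prod>i<m. 1 - q * Q ^ i)" for m
  define G where "G k = (\<Prod>j<k. inverse Q ^ k) * (\<Prod>j\<in>{k<..M}. - (inverse Q ^ j)) *
     (\<Prod>i<k. - (Q ^ i * inverse Q ^ M)) * (inverse Q ^ M / q) ^ (M - k)" for k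
  have P0: "P m \<noteq> 0" for m using Q_power[of "Suc _"] unfolding P_def prod_zero_iff[OF finite_lessThan] by fastforce
  have main: "(1 - q * Q ^ (2 * k)) * poly (term_poly q Q M k) (inverse Q ^ M / q)
      * poly (term_poly q Q M k) 1 * (\<Prod>j\<in>{..M} - {k}. node k - node j) =
      G k * P M * P M * R (2 * M + 1)" if k: "k \<le> M" for k
  proof -
    have PM: "P M = P k * (\<Prod>i\<in>{k<..M}. 1 - Q ^ i)"
    proof -
      have "P M = (\<Prod>i\<in>{0<..M}. 1 - Q ^ i)" "P k = (\<Prod>i\<in>{0<..k}. 1 - Q ^ i)"
        unfolding P_def by (rule prod.reindex_bij_witness[of _ "\<lambda>i. i - 1" Suc]; auto)+
      moreover have "{0<..M} = {0<..k} \<union> {k<..M}" "{0<..k} \<inter> {k<..M} = {}" using k by auto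
      ultimately show ?thesis by (simp add: prod.union_disjoint)
    qed
    have shiftR: "R (a + m) = R a * (\<Prod>i<m. 1 - q * Q ^ (a + i))" for a m
      by (induction m) (simp_all add: R_def)
    have one: "poly (term_poly q Q M k) 1 * P k = R k * P M"
      by (simp add: poly_term_poly R_def PM)
    have B: "(\<Prod>i<k. 1 - Q ^ i * inverse Q ^ M) * P (M - k) = P M * (\<Prod>i<k. - (Q ^ i * inverse Q ^ M))"
      using k
    proof (induction k)
      case (Suc k)
      have "M - k = Suc (M - Suc k)" using Suc.prems by simp
      then have "P (M - k) = P (M - Suc k) * (1 - Q ^ (M - k))" by (simp add: P_def)
      moreover have "- (Q ^ k * inverse Q ^ M) * (1 - Q ^ (M - k)) = 1 - Q ^ k * inverse Q ^ M"
      proof -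
        have "Q ^ k * Q ^ (M - k) = Q ^ M" using Suc.prems by (simp flip: power_add)
        then have "Q ^ k * inverse Q ^ M * Q ^ (M - k) = 1"
          by (metis inverse_power_mult(1) mult.assoc mult.commute)
        then show ?thesis by (simp add: algebra_simps)
      qed
      ultimately have s: "(1 - Q ^ k * inverse Q ^ M) * P (M - Suc k) = - (Q ^ k * inverse Q ^ M) * P (M - k)"
        by (metis mult.assoc mult.commute)
      have "(\<Prod>i<Suc k. 1 - Q ^ i * inverse Q ^ M) * P (M - Suc k) =
          (\<Prod>i<k. 1 - Q ^ i * inverse Q ^ M) * ((1 - Q ^ k * inverse Q ^ M) * P (M - Suc k))" by simp
      also have "\<dots> = ((\<Prod>i<k. 1 - Q ^ i * inverse Q ^ M) * P (M - k)) * - (Q ^ k * inverse Q ^ M)"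
        unfolding s by (simp only: mult_ac)
      also have "\<dots> = P M * (\<Prod>i<Suc k. - (Q ^ i * inverse Q ^ M))"
        using Suc by simp
      finally show ?case .
    qed simp
    have c1: "poly (term_poly q Q M k) (inverse Q ^ M / q) =
       (\<Prod>i<k. 1 - Q ^ i * inverse Q ^ M) * ((inverse Q ^ M / q) ^ (M - k) * (\<Prod>i\<in>{k<..M}. 1 - q * Q ^ (M + i)))"
    proof -
      have "(\<Prod>i\<in>{k<..M}. inverse Q ^ M / q - Q ^ i) = (\<Prod>i\<in>{k<..M}. inverse Q ^ M / q * (1 - q * Q ^ (M + i)))"
        by (rule prod.cong) (use q0 Q0 in \<open>simp_all add: field_simps power_add\<close>)
      moreover have "(\<Prod>i<k. 1 - q * Q ^ i * (inverse Q ^ M / q)) = (\<Prod>i<k. 1 - Q ^ i * inverse Q ^ M)"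
        by (rule prod.cong) (use q0 in simp_all)
      ultimately show ?thesis
        unfolding poly_term_poly by (simp only: prod.distrib prod_constant card_greaterThanAtMost)
    qed
    have R2: "R (M + k + 1) * (\<Prod>i\<in>{k<..M}. 1 - q * Q ^ (M + i)) = R (2 * M + 1)"
    proof -
      have "(\<Prod>i\<in>{k<..M}. 1 - q * Q ^ (M + i)) = (\<Prod>i<M - k. 1 - q * Q ^ ((M + k + 1) + i))"
        by (rule prod.reindex_bij_witness[of _ "\<lambda>i. i + k + 1" "\<lambda>i. i - (k + 1)"]) (auto simp: add_ac)
      then have "R (M + k + 1) * (\<Prod>i\<in>{k<..M}. 1 - q * Q ^ (M + i)) = R (M + k + 1 + (M - k))"
        unfolding shiftR[of "M + k + 1"] by simp
      then show ?thesis using k by (simp add: mult_2)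
    qed
    have split: "{..M} - {k} = {..<k} \<union> {k<..M}" using k by auto
    have D: "(1 - q * Q ^ (2 * k)) * R k * (\<Prod>j\<in>{..M} - {k}. node k - node j) =
        R (M + k + 1) * P k * P (M - k) * ((\<Prod>j<k. inverse Q ^ k) * (\<Prod>j\<in>{k<..M}. - (inverse Q ^ j)))"
    proof -
      have a: "(\<Prod>j<k. node k - node j) = (\<Prod>j<k. inverse Q ^ k) * P k * (\<Prod>j<k. 1 - q * Q ^ (k + j))"
      proof -
        have "(\<Prod>j<k. node k - node j) = (\<Prod>j<k. inverse Q ^ k * (1 - Q ^ (k - j)) * (1 - q * Q ^ (k + j)))"
          by (rule prod.cong) (auto simp: node_diff add.commute)
        moreover have "(\<Prod>j<k. 1 - Q ^ (k - j)) = P k"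
          unfolding P_def
          by (rule prod.reindex_bij_witness[of _ "\<lambda>i. k - Suc i" "\<lambda>i. k - Suc i"])
            (simp_all add: Suc_diff_Suc del: power_Suc)
        ultimately show ?thesis by (simp only: prod.distrib)
      qed
      have b: "(\<Prod>j\<in>{k<..M}. node k - node j) =
          (\<Prod>j\<in>{k<..M}. - (inverse Q ^ j)) * P (M - k) * (\<Prod>j\<in>{k<..M}. 1 - q * Q ^ (k + j))"
      proof -
        have "(\<Prod>j\<in>{k<..M}. node k - node j) =
            (\<Prod>j\<in>{k<..M}. - (inverse Q ^ j) * (1 - Q ^ (j - k)) * (1 - q * Q ^ (k + j)))"
        proof (rule prod.cong)
          fix j assume "j \<in> {k<..M}"
          then have "node k - node j = - (inverse Q ^ j * (1 - Q ^ (j - k)) * (1 - q * Q ^ (k + j)))"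
            using node_diff[of k j] by (simp add: algebra_simps)
          then show "node k - node j = - (inverse Q ^ j) * (1 - Q ^ (j - k)) * (1 - q * Q ^ (k + j))" by simp
        qed simp
        moreover have "(\<Prod>j\<in>{k<..M}. 1 - Q ^ (j - k)) = P (M - k)"
          unfolding P_def
          by (rule prod.reindex_bij_witness[of _ "\<lambda>i. i + Suc k" "\<lambda>i. i - Suc k"])
            (auto simp: Suc_diff_Suc simp del: power_Suc)
        ultimately show ?thesis by (simp only: prod.distrib)
      qed
      have "(\<Prod>j<k. 1 - q * Q ^ (k + j)) * (\<Prod>j\<in>{k<..M}. 1 - q * Q ^ (k + j)) * (1 - q * Q ^ (2 * k))
         = (\<Prod>j<M+1. 1 - q * Q ^ (k + j))"
      proof -
        have "{..<M+1} = insert k ({..<k} \<union> {k<..M})" using k by auto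
        then have "(\<Prod>j<M+1. 1 - q * Q ^ (k + j)) = (1 - q * Q ^ (k + k)) *
            (\<Prod>j\<in>{..<k} \<union> {k<..M}. 1 - q * Q ^ (k + j))" by (subst prod.insert[symmetric]) auto
        also have "(\<Prod>j\<in>{..<k} \<union> {k<..M}. 1 - q * Q ^ (k + j)) =
            (\<Prod>j<k. 1 - q * Q ^ (k + j)) * (\<Prod>j\<in>{k<..M}. 1 - q * Q ^ (k + j))"
          by (rule prod.union_disjoint) auto
        finally show ?thesis unfolding mult_2 by (simp only: mult_ac)
      qed
      then have "R k * ((\<Prod>j<k. 1 - q * Q ^ (k + j)) * (\<Prod>j\<in>{k<..M}. 1 - q * Q ^ (k + j)) * (1 - q * Q ^ (2 * k)))
         = R (M + k + 1)"
        using shiftR[of k "M + 1"] by (simp only: add_ac)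
      moreover have "(\<Prod>j\<in>{..M} - {k}. node k - node j) = (\<Prod>j<k. node k - node j) * (\<Prod>j\<in>{k<..M}. node k - node j)"
        unfolding split by (rule prod.union_disjoint) auto
      ultimately show ?thesis unfolding a b by (simp only: mult_ac)
    qed
    have "((1 - q * Q ^ (2 * k)) * poly (term_poly q Q M k) (inverse Q ^ M / q)
      * poly (term_poly q Q M k) 1 * (\<Prod>j\<in>{..M} - {k}. node k - node j)) * P k =
      (poly (term_poly q Q M k) 1 * P k) * poly (term_poly q Q M k) (inverse Q ^ M / q)
       * ((1 - q * Q ^ (2 * k)) * (\<Prod>j\<in>{..M} - {k}. node k - node j))"
      by (simp only: mult_ac)
    also have "\<dots> = P M * poly (term_poly q Q M k) (inverse Q ^ M / q) *
        ((1 - q * Q ^ (2 * k)) * R k * (\<Prod>j\<in>{..M} - {k}. node k - node j))"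
      unfolding one by (simp only: mult_ac)
    also have "\<dots> = P M * ((\<Prod>i<k. 1 - Q ^ i * inverse Q ^ M) * P (M - k)) * (inverse Q ^ M / q) ^ (M - k) *
        (R (M + k + 1) * (\<Prod>i\<in>{k<..M}. 1 - q * Q ^ (M + i))) * P k *
        ((\<Prod>j<k. inverse Q ^ k) * (\<Prod>j\<in>{k<..M}. - (inverse Q ^ j)))"
      unfolding D c1 by (simp only: mult_ac)
    also have "\<dots> = (G k * P M * P M * R (2 * M + 1)) * P k"
      unfolding B R2 G_def by (simp only: mult_ac)
    finally show ?thesis using P0[of k] by simp
  qed
  have G: "G k = q ^ k * G 0" if "k \<le> M" for k
    using that
  proof (induction k)
    case (Suc k)
    then have k: "k < M" by simp
    have "{k<..M} = insert (Suc k) {Suc k<..M}" using k by auto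
    then have e2: "(\<Prod>j\<in>{k<..M}. - (inverse Q ^ j)) = - (inverse Q ^ Suc k) * (\<Prod>j\<in>{Suc k<..M}. - (inverse Q ^ j))"
      by simp
    have e3: "(inverse Q ^ M / q) ^ (M - k) = (inverse Q ^ M / q) * (inverse Q ^ M / q) ^ (M - Suc k)"
      using k by (metis Suc_diff_Suc power_Suc)
    have e1: "(\<Prod>j<Suc k. inverse Q ^ Suc k) = inverse Q ^ k * inverse Q ^ k * inverse Q * (\<Prod>j<k. inverse Q ^ k)"
      by (simp add: power_add mult_ac power_mult_distrib flip: power_mult)
    have "G (Suc k) = q * G k"
      unfolding G_def e1 e2 e3 using q0 Q0 by (simp add: field_simps)
    then show ?case using Suc by simp
  qed simp
  show ?thesis using main[OF assms] main[of 0] G[OF assms] by (simp add: mult_ac)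
qed

text \<open>Since \<open>(q c) (q c') = q Q^r\<close>, the denominators belonging to \<open>c\<close> are, up to constants, the
  numerators belonging to \<open>c'\<close> shifted by \<open>r - 1\<close> places, and vice versa. What survives is a product
  of \<open>2 (r - 1)\<close> linear factors in \<open>Q^k\<close>; the factor with \<open>q c\<close> and index \<open>i\<close> and the one with
  \<open>q c'\<close> and index \<open>r - i\<close> combine into a multiple of a linear polynomial in the node.\<close>

lemma paired_factors:
  assumes cc: "c * c' = Q ^ r / q" and r: "r > 0"
    and nz: "\<And>i. i \<in> {0<..M} \<Longrightarrow> c \<noteq> Q ^ i \<and> c' \<noteq> Q ^ i"
      "\<And>i. i \<in> {0<..<r} \<Longrightarrow> q * c \<noteq> Q ^ i \<and> q * c' \<noteq> Q ^ i"
  obtains g where "degree g \<le> r - 1"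
    "\<And>k. k \<le> M \<Longrightarrow> poly (term_poly q Q M k) c * poly (term_poly q Q M k) c' = (q / Q) ^ k * poly g (node k)"
proof -
  define H where "H b k = (\<Prod>i\<in>{0<..<r}. 1 - b * Q ^ k * inverse Q ^ i)" for b k
  define G where "G k = (q * inverse Q ^ r) ^ k * H (q * c) k * H (q * c') k" for k
  define psi where "psi k = poly (term_poly q Q M k) c * poly (term_poly q Q M k) c'" for k
  have H_Suc: "H b (Suc k) * (1 - b * Q ^ k * inverse Q ^ (r - 1)) = H b k * (1 - b * Q ^ k)" for b k
  proof -
    let ?f = "\<lambda>i. 1 - b * Q ^ k * inverse Q ^ i"
    have "H b (Suc k) = (\<Prod>i<r - 1. ?f i)"
      unfolding H_def by (rule prod.reindex_bij_witness[of _ Suc "\<lambda>i. i - 1"])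
        (use Q0 in \<open>auto simp: gr0_conv_Suc\<close>)
    then have "H b (Suc k) * ?f (r - 1) = (\<Prod>i<Suc (r - 1). ?f i)" by simp
    also have "{..<Suc (r - 1)} = insert 0 {0<..<r}" using r by auto
    also have "prod ?f \<dots> = H b k * (1 - b * Q ^ k)" unfolding H_def by simp
    finally show ?thesis .
  qed
  have r': "inverse Q ^ r * Q = inverse Q ^ (r - 1)"
    using r Q0 by (cases r) simp_all
  \<comment> \<open>The denominator of one parameter of the pair is a shifted numerator of the other.\<close>
  have low: "c - Q ^ Suc k = c * (1 - q * c' * Q ^ k * inverse Q ^ (r - 1))" 
    if "c * c' = Q ^ r / q" for k c c'
  proof -
    have "c * (q * c' * Q ^ k * inverse Q ^ (r - 1)) = (q * (c * c')) * Q ^ k * (inverse Q ^ r * Q)"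
      unfolding r' by (simp only: mult_ac)
    also have "\<dots> = Q ^ Suc k" unfolding that using q0 by simp
    finally show ?thesis by (simp add: algebra_simps)
  qed
  have step: "psi (Suc k) * G 0 = psi 0 * G (Suc k)" if "k < M" and IH: "psi k * G 0 = psi 0 * G k" for k
  proof -
    let ?x = "1 - q * c * Q ^ k * inverse Q ^ (r - 1)" and ?y = "1 - q * c' * Q ^ k * inverse Q ^ (r - 1)"
    have l: "(c - Q ^ Suc k) * (c' - Q ^ Suc k) = Q ^ r / q * (?x * ?y)"
    proof -
      have "(c - Q ^ Suc k) * (c' - Q ^ Suc k) = (c * ?y) * (c' * ?x)"
        using low[OF cc, of k] low[of c' c k] cc by (simp only: mult.commute[of c' c])
      also have "\<dots> = (c * c') * (?x * ?y)" by (simp only: mult_ac)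
      finally show ?thesis unfolding cc .
    qed
    have nz': "(c - Q ^ Suc k) * (c' - Q ^ Suc k) \<noteq> 0" using nz(1)[of "Suc k"] that by auto
    have "psi (Suc k) * ((c - Q ^ Suc k) * (c' - Q ^ Suc k)) =
       (poly (term_poly q Q M (Suc k)) c * (c - Q ^ Suc k)) * (poly (term_poly q Q M (Suc k)) c' * (c' - Q ^ Suc k))"
      unfolding psi_def by (simp only: mult_ac)
    also have "\<dots> = psi k * ((1 - q * c * Q ^ k) * (1 - q * c' * Q ^ k))"
      unfolding poly_term_poly_Suc[OF \<open>k < M\<close>] psi_def by (simp only: mult_ac)
    finally have 1: "psi (Suc k) * ((c - Q ^ Suc k) * (c' - Q ^ Suc k)) = psi k * ((1 - q * c * Q ^ k) * (1 - q * c' * Q ^ k))" .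
    have "G (Suc k) * ((c - Q ^ Suc k) * (c' - Q ^ Suc k)) =
      (q * inverse Q ^ r) ^ k * (q * inverse Q ^ r * (Q ^ r / q)) * (H (q * c) (Suc k) * ?x) * (H (q * c') (Suc k) * ?y)"
      unfolding l G_def by (simp only: power_Suc mult_ac)
    also have "q * inverse Q ^ r * (Q ^ r / q) = 1" using q0 by simp
    also have "(q * inverse Q ^ r) ^ k * 1 * (H (q * c) (Suc k) * ?x) * (H (q * c') (Suc k) * ?y)
        = G k * ((1 - q * c * Q ^ k) * (1 - q * c' * Q ^ k))"
      unfolding H_Suc G_def mult_1_right by (simp only: mult_ac)
    finally have 2: "G (Suc k) * ((c - Q ^ Suc k) * (c' - Q ^ Suc k)) = G k * ((1 - q * c * Q ^ k) * (1 - q * c' * Q ^ k))" .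
    let ?L = "(c - Q ^ Suc k) * (c' - Q ^ Suc k)" and ?X = "(1 - q * c * Q ^ k) * (1 - q * c' * Q ^ k)"
    have "(psi (Suc k) * G 0) * ?L = (psi k * G 0) * ?X"
      using arg_cong[OF 1, of "\<lambda>x. x * G 0"] by (simp only: mult_ac)
    also have "\<dots> = (psi 0 * G (Suc k)) * ?L"
      unfolding IH using arg_cong[OF 2, of "\<lambda>x. x * psi 0"] by (simp only: mult_ac)
    finally show ?thesis using nz' by simp
  qed
  have H_nz: "H b 0 \<noteq> 0" if b: "\<And>i. i \<in> {0<..<r} \<Longrightarrow> b \<noteq> Q ^ i" for b
  proof -
    have "1 - b * Q ^ 0 * inverse Q ^ i \<noteq> 0" if "i \<in> {0<..<r}" for i
    proof
      assume "1 - b * Q ^ 0 * inverse Q ^ i = 0"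
      then have e: "b * inverse Q ^ i = 1" by simp
      have "b = (b * inverse Q ^ i) * Q ^ i" by (simp only: mult.assoc inverse_power_mult mult_1_right)
      then have "b = Q ^ i" unfolding e by simp
      then show False using b[OF that] by simp
    qed
    then show ?thesis unfolding H_def by simp
  qed
  have H0: "H (q * c) 0 \<noteq> 0" "H (q * c') 0 \<noteq> 0" by (rule H_nz, use nz(2) in simp)+
  have G0: "G 0 \<noteq> 0" using H0 by (simp add: G_def)
  have psi: "psi k * G 0 = psi 0 * G k" if "k \<le> M" for k
    using that
  proof (induction k)
    case (Suc k)
    then show ?case using step[of k] by simp
  qed simp
  define g where "g = smult (psi 0 / G 0) (\<Prod>i\<in>{0<..<r}. [:- (q * c * inverse Q ^ i + q * c' * inverse Q ^ (r - i)), 1:])"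
  have "degree g \<le> r - 1"
    unfolding g_def by (rule order.trans[OF degree_smult_le], subst degree_prod_eq_sum_degree) auto
  moreover have "psi k = (q / Q) ^ k * poly g (node k)" if "k \<le> M" for k
  proof -
    have refl': "H (q * c') k = (\<Prod>i\<in>{0<..<r}. 1 - q * c' * Q ^ k * inverse Q ^ (r - i))"
      unfolding H_def by (rule prod.reindex_bij_witness[of _ "\<lambda>i. r - i" "\<lambda>i. r - i"]) auto
    have "H (q * c) k * H (q * c') k = (\<Prod>i\<in>{0<..<r}. Q ^ k * (node k - (q * c * inverse Q ^ i + q * c' * inverse Q ^ (r - i))))"
      unfolding refl' unfolding H_def prod.distrib[symmetric]
    proof (rule prod.cong)
      fix i assume i: "i \<in> {0<..<r}"
      have "(1 - q * c * Q ^ k * inverse Q ^ i) * (1 - q * c' * Q ^ k * inverse Q ^ (r - i)) =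
        1 - Q ^ k * (q * c * inverse Q ^ i + q * c' * inverse Q ^ (r - i)) +
        (q * (q * (c * c')) * (inverse Q ^ i * inverse Q ^ (r - i))) * Q ^ k * Q ^ k"
        by (simp add: algebra_simps)
      also have "inverse Q ^ i * inverse Q ^ (r - i) = inverse Q ^ r" using i by (simp flip: power_add)
      also have "q * (q * (c * c')) * inverse Q ^ r = q" unfolding cc using q0 by simp
      also have "1 - Q ^ k * (q * c * inverse Q ^ i + q * c' * inverse Q ^ (r - i)) + q * Q ^ k * Q ^ k
        = Q ^ k * (node k - (q * c * inverse Q ^ i + q * c' * inverse Q ^ (r - i)))"
        by (simp add: node_def algebra_simps)
      finally show "(1 - q * c * Q ^ k * inverse Q ^ i) * (1 - q * c' * Q ^ k * inverse Q ^ (r - i)) = \<dots>" .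
    qed simp
    also have "\<dots> = (Q ^ k) ^ (r - 1) * (\<Prod>i\<in>{0<..<r}. node k - (q * c * inverse Q ^ i + q * c' * inverse Q ^ (r - i)))"
      by (simp add: prod.distrib)
    finally have HH: "H (q * c) k * H (q * c') k = \<dots>" .
    have pw: "(q * inverse Q ^ r) ^ k * (Q ^ k) ^ (r - 1) = (q / Q) ^ k"
    proof -
      have "(q * inverse Q ^ r) ^ k * (Q ^ k) ^ (r - 1) = (q * (inverse Q ^ r * Q ^ (r - 1))) ^ k"
        by (simp add: power_mult_distrib mult.commute flip: power_mult)
      also have "inverse Q ^ r * Q ^ (r - 1) = inverse Q"
        using r Q0 by (cases r) simp_all
      finally show ?thesis by (simp add: divide_inverse)
    qed
    have "G k = (q / Q) ^ k * (\<Prod>i\<in>{0<..<r}. node k - (q * c * inverse Q ^ i + q * c' * inverse Q ^ (r - i)))"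
      unfolding G_def pw[symmetric] using HH by (simp only: mult.assoc)
    moreover have "psi k = psi 0 / G 0 * G k" using psi[OF that] G0 by (simp add: field_simps)
    ultimately show ?thesis by (simp add: g_def poly_prod algebra_simps)
  qed
  ultimately show ?thesis using that[of g] unfolding psi_def by blast
qed

text \<open>The powers of \<open>q\<close> and \<open>Q\<close> left over by the two previous lemmas cancel against
  \<open>Q^((d - 2) k)\<close>, so that the sum is a multiple of a divided difference of a polynomial of degree
  at most \<open>(d - 1) (r - 1) = M + 2 - d < M\<close>; this is where \<open>d \<ge> 3\<close> enters.\<close>

lemma vanishing_sum:
  assumes d: "d \<ge> 3" and r: "r > 0" and M: "M = (d - 1) * r - 1" and Q: "Q = q ^ d"
    and cc: "c * c' = Q ^ r / q"
    and nz: "\<And>i. i \<in> {0<..M} \<Longrightarrow> c \<noteq> Q ^ i \<and> c' \<noteq> Q ^ i"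
      "\<And>i. i \<in> {0<..<r} \<Longrightarrow> q * c \<noteq> Q ^ i \<and> q * c' \<noteq> Q ^ i"
  shows "(\<Sum>k\<le>M. (1 - q * Q ^ (2 * k)) * Q ^ ((d - 2) * k) *
           (poly (term_poly q Q M k) (inverse Q ^ M / q) * poly (term_poly q Q M k) 1 *
            (poly (term_poly q Q M k) c * poly (term_poly q Q M k) c') ^ (d - 1))) = 0"
proof -
  obtain g where g: "degree g \<le> r - 1"
    "\<And>k. k \<le> M \<Longrightarrow> poly (term_poly q Q M k) c * poly (term_poly q Q M k) c' = (q / Q) ^ k * poly g (node k)"
    using paired_factors[OF cc r nz] by blast
  define D where "D k = (\<Prod>j\<in>{..M} - {k}. node k - node j)" for k
  define C where "C = poly (term_poly q Q M 0) (inverse Q ^ M / q) * poly (term_poly q Q M 0) 1 * (1 - q) * D 0"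
  have D0: "D k \<noteq> 0" for k using inj_node by (auto simp: D_def inj_def)
  have "(\<Sum>k\<le>M. (1 - q * Q ^ (2 * k)) * Q ^ ((d - 2) * k) *
           (poly (term_poly q Q M k) (inverse Q ^ M / q) * poly (term_poly q Q M k) 1 *
            (poly (term_poly q Q M k) c * poly (term_poly q Q M k) c') ^ (d - 1)))
     = (\<Sum>k\<le>M. C * (poly (g ^ (d - 1)) (node k) / D k))"
  proof (rule sum.cong)
    fix k assume "k \<in> {..M}"
    then have k: "k \<le> M" by simp
    have t: "(1 - q * Q ^ (2 * k)) * (poly (term_poly q Q M k) (inverse Q ^ M / q) * poly (term_poly q Q M k) 1)
        = q ^ k * C / D k"
      using terminating_factor[OF k] D0[of k] by (simp add: D_def C_def field_simps)
    have pw: "Q ^ ((d - 2) * k) * q ^ k * ((q / Q) ^ k) ^ (d - 1) = 1"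
    proof -
      have "Q ^ ((d - 2) * k) * q ^ k * ((q / Q) ^ k) ^ (d - 1) = (Q ^ (d - 2) * q * (q / Q) ^ (d - 1)) ^ k"
        by (simp add: power_mult_distrib mult.commute flip: power_mult)
      also have "Q ^ (d - 2) * q * (q / Q) ^ (d - 1) = 1"
      proof -
        have e: "d - 1 = Suc (d - 2)" "d = Suc (Suc (d - 2))" using d by auto
        have "Q ^ (d - 2) * q * (q / Q) ^ Suc (d - 2) = q ^ Suc (Suc (d - 2)) / Q"
          using Q0 by (simp add: power_divide)
        then show ?thesis using e Q Q0 by (metis divide_self)
      qed
      finally show ?thesis by simp
    qed
    show "(1 - q * Q ^ (2 * k)) * Q ^ ((d - 2) * k) *
           (poly (term_poly q Q M k) (inverse Q ^ M / q) * poly (term_poly q Q M k) 1 *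
            (poly (term_poly q Q M k) c * poly (term_poly q Q M k) c') ^ (d - 1))
        = C * (poly (g ^ (d - 1)) (node k) / D k)" (is "?l = _")
    proof -
      have "?l = ((1 - q * Q ^ (2 * k)) * (poly (term_poly q Q M k) (inverse Q ^ M / q) * poly (term_poly q Q M k) 1)) *
         Q ^ ((d - 2) * k) * (((q / Q) ^ k) ^ (d - 1) * poly g (node k) ^ (d - 1))"
        unfolding g(2)[OF k] power_mult_distrib by (simp only: mult_ac)
      also have "\<dots> = (Q ^ ((d - 2) * k) * q ^ k * ((q / Q) ^ k) ^ (d - 1)) * (C * (poly (g ^ (d - 1)) (node k) / D k))"
        unfolding t by simp
      finally show ?thesis unfolding pw by simp
    qed
  qed simp
  also have "\<dots> = C * (\<Sum>k\<le>M. poly (g ^ (d - 1)) (node k) / D k)" by (simp add: sum_distrib_left)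
  also have "(\<Sum>k\<le>M. poly (g ^ (d - 1)) (node k) / D k) = 0"
    unfolding D_def
  proof (rule sum_divided_differences_eq_0)
    show "inj_on node {..M}" using inj_node by (rule inj_on_subset) simp
    have "degree (g ^ (d - 1)) \<le> (d - 1) * (r - 1)"
      using g(1) by (metis (no_types) degree_power_le mult.commute mult_le_mono1 order.trans)
    also have "\<dots> < M"
    proof -
      have "(d - 1) * r = (d - 1) * (r - 1) + (d - 1)" using r by (cases r) simp_all
      then show ?thesis using d unfolding M by linarith
    qed
    finally show "degree (g ^ (d - 1)) < M" .
  qed
  finally show ?thesis by simp
qed

end

section \<open>Antisymmetry at a root of unity\<close>

text \<open>As \<open>z Q^M = 1\<close>, the zeros \<open>1 / (z Q^i)\<close> of the first product in \<open>term_poly\<close> are the powers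
  \<open>Q^(M - i)\<close>. Hence, up to scaling, \<open>term_poly z Q M k\<close> is symmetric under \<open>k \<mapsto> M - k\<close>, and after
  absorbing the scalars the remaining weight \<open>(1 - z Q^(2 k)) Q^(d k^2)\<close> is antisymmetric. The
  statement allows any homogeneous \<open>H\<close> of degree \<open>2 d\<close> because it is needed for the values at 1
  as well as for a coefficient of a Taylor expansion.\<close>

lemma antisymmetric_sum:
  fixes z Q :: "'a::field_char_0"
  assumes zQM: "z * Q ^ M = 1" and Q: "Q = z ^ d" and d: "d \<ge> 2"
    and H: "\<And>a p. a \<noteq> 0 \<Longrightarrow> H (smult a p) = a ^ (2 * d) * H p"
  shows "(\<Sum>k\<le>M. (1 - z * Q ^ (2 * k)) * Q ^ ((d - 2) * k) * H (term_poly z Q M k)) = 0"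
proof -
  define sym where "sym k = (\<Prod>i\<in>{M - k<..M}. [:- (Q ^ i), 1:]) * (\<Prod>i\<in>{k<..M}. [:- (Q ^ i), 1:])" for k
  define w where "w k = (1 - z * Q ^ (2 * k)) * Q ^ (d * k ^ 2)" for k
  define l where "l k = (\<Prod>i<k. - (z * Q ^ i))" for k
  have z0: "z \<noteq> 0" using zQM by auto
  then have Q0: "Q \<noteq> 0" using Q by auto
  have scaled: "term_poly z Q M k = smult (l k) (sym k)" if "k \<le> M" for k
  proof -
    have "(\<Prod>i<k. [:1, - (z * Q ^ i):]) = (\<Prod>i<k. smult (- (z * Q ^ i)) [:- (Q ^ (M - i)), 1:])"
    proof (rule prod.cong)
      fix i assume "i \<in> {..<k}"
      then have "Q ^ i * Q ^ (M - i) = Q ^ M" using that by (simp flip: power_add)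
      then show "[:1, - (z * Q ^ i):] = smult (- (z * Q ^ i)) [:- (Q ^ (M - i)), 1:]"
        using zQM by (simp add: mult.assoc)
    qed simp
    also have "\<dots> = smult (l k) (\<Prod>i<k. [:- (Q ^ (M - i)), 1:])"
      unfolding l_def by (rule prod_smult)
    also have "(\<Prod>i<k. [:- (Q ^ (M - i)), 1:]) = (\<Prod>i\<in>{M - k<..M}. [:- (Q ^ i), 1:])"
      by (rule prod.reindex_bij_witness[of _ "\<lambda>i. M - i" "\<lambda>i. M - i"]) (use that in auto)
    finally show ?thesis by (simp add: term_poly_def sym_def)
  qed
  have lpow: "l k ^ (2 * d) * Q ^ ((d - 2) * k) = Q ^ (d * k ^ 2)" for k
  proof (induction k)
    case (Suc k)
    have e: "(- (z * Q ^ k)) ^ (2 * d) = Q ^ 2 * Q ^ (2 * d * k)"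
      by (simp add: Q power_mult_distrib mult_ac flip: power_mult)
    have "l (Suc k) ^ (2 * d) * Q ^ ((d - 2) * Suc k) =
        (l k ^ (2 * d) * Q ^ ((d - 2) * k)) * (- (z * Q ^ k)) ^ (2 * d) * Q ^ (d - 2)"
      by (simp add: l_def power_mult_distrib power_add mult_ac)
    also have "\<dots> = Q ^ (d * k ^ 2 + 2 + 2 * d * k + (d - 2))"
      unfolding Suc e by (simp only: power_add mult_ac)
    also have "d * k ^ 2 + 2 + 2 * d * k + (d - 2) = d * (Suc k) ^ 2"
      using d by (simp add: power2_eq_square algebra_simps)
    finally show ?case .
  qed (simp add: l_def)
  have l0: "l k \<noteq> 0" for k using z0 Q0 by (simp add: l_def)
  have w: "w (M - k) = - w k" if k: "k \<le> M" for k
  proof -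
    define j where "j = M - k"
    have M: "M = j + k" using k by (simp add: j_def)
    have z1: "z * (Q ^ j * Q ^ k) = 1" using zQM by (simp add: M power_add)
    have "Q * Q ^ (d * (j + k)) = (z * Q ^ M) ^ d"
      by (simp add: M Q power_mult_distrib mult_ac flip: power_mult)
    then have base: "Q ^ (1 + d * (j + k)) = 1" unfolding zQM by simp
    have "Q ^ (j * (1 + d * (j + k))) = 1" "Q ^ (k * (1 + d * (j + k))) = 1"
      using base by (simp_all only: power_mult[of Q "1 + d * (j + k)"] mult.commute[of _ "1 + d * (j + k)"] power_one)
    moreover have "Q ^ (j * (1 + d * (j + k))) = Q ^ (d * j ^ 2) * Q ^ j * Q ^ (d * j * k)"
       "Q ^ (k * (1 + d * (j + k))) = Q ^ (d * k ^ 2) * Q ^ k * Q ^ (d * j * k)"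
      by (simp_all add: power2_eq_square algebra_simps flip: power_add)
    ultimately have AB: "Q ^ (d * j ^ 2) * Q ^ j = Q ^ (d * k ^ 2) * Q ^ k"
      using Q0 by (metis mult_right_cancel power_not_zero)
    have "(w j + w k) * (Q ^ j * Q ^ k) =
       (Q ^ (d * j ^ 2) * Q ^ j) * (Q ^ k - (z * (Q ^ j * Q ^ k)) * Q ^ j)
       + (Q ^ (d * k ^ 2) * Q ^ k) * (Q ^ j - (z * (Q ^ j * Q ^ k)) * Q ^ k)"
    proof -
      have "Q ^ (2 * i) = Q ^ i * Q ^ i" for i by (simp add: mult_2 power_add)
      then show ?thesis by (simp add: w_def algebra_simps)
    qed
    also have "\<dots> = 0" unfolding z1 AB by (simp add: algebra_simps)
    finally have "w j + w k = 0" using Q0 by simp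
    then show ?thesis by (simp add: j_def eq_neg_iff_add_eq_0)
  qed
  have sym: "sym (M - k) = sym k" if "k \<le> M" for k
    using that by (simp add: sym_def mult.commute)
  define S where "S = (\<Sum>k\<le>M. w k * H (sym k))"
  have "S = (\<Sum>k\<le>M. w (M - k) * H (sym (M - k)))"
    unfolding S_def by (rule sum.reindex_bij_witness[of _ "\<lambda>k. M - k" "\<lambda>k. M - k"]) auto
  also have "\<dots> = - S"
    unfolding S_def sum_negf[symmetric] by (rule sum.cong) (simp_all add: w sym)
  finally have "S = 0" by simp
  moreover have "(1 - z * Q ^ (2 * k)) * Q ^ ((d - 2) * k) * H (term_poly z Q M k) = w k * H (sym k)"
    if "k \<le> M" for k
    unfolding scaled[OF that] H[OF l0] w_def lpow[symmetric] by (simp only: mult_ac)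
  ultimately show ?thesis by (simp add: S_def)
qed


section \<open>Products of exponential expansions modulo the fourth power\<close>

definition cong_X4 :: "complex fps \<Rightarrow> complex fps \<Rightarrow> bool" where
  "cong_X4 f g \<longleftrightarrow> fps_X ^ 4 dvd f - g"

lemma cong_X4_refl [simp]: "cong_X4 f f" by (simp add: cong_X4_def)

lemma cong_X4_sym: "cong_X4 f g \<Longrightarrow> cong_X4 g f"
  unfolding cong_X4_def by (subst dvd_minus_iff[symmetric]) simp

lemma cong_X4_trans [trans]: "cong_X4 f g \<Longrightarrow> cong_X4 g h \<Longrightarrow> cong_X4 f h"
  unfolding cong_X4_def using dvd_add[of _ "f - g" "g - h"] by simp

lemma cong_X4_add: "cong_X4 f g \<Longrightarrow> cong_X4 f' g' \<Longrightarrow> cong_X4 (f + f') (g + g')"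
  unfolding cong_X4_def using dvd_add[of _ "f - g" "f' - g'"] by (simp add: algebra_simps)

lemma cong_X4_mult: 
  assumes "cong_X4 f g" "cong_X4 f' g'" shows "cong_X4 (f * f') (g * g')"
proof -
  have "f * f' - g * g' = (f - g) * f' + g * (f' - g')" by (simp add: algebra_simps)
  then show ?thesis using assms unfolding cong_X4_def by (simp only: dvd_add dvd_mult dvd_mult2)
qed

lemma cong_X4_power: "cong_X4 f g \<Longrightarrow> cong_X4 (f ^ k) (g ^ k)"
  by (induction k) (simp_all add: cong_X4_mult)

lemma cong_X4_sum: "(\<And>x. x \<in> A \<Longrightarrow> cong_X4 (f x) (g x)) \<Longrightarrow> cong_X4 (sum f A) (sum g A)"
  by (induction A rule: infinite_finite_induct) (simp_all add: cong_X4_add)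

definition exp_upto3 :: "complex fps \<Rightarrow> complex fps" where
  "exp_upto3 s = 1 + s + fps_const (1/2) * s ^ 2 + fps_const (1/6) * s ^ 3"

lemma cong_X4I: "f = g + fps_X ^ 4 * h \<Longrightarrow> cong_X4 f g"
  by (simp add: cong_X4_def)

lemma exp_upto3_add:
  assumes "fps_X dvd s" "fps_X dvd t"
  shows "cong_X4 (exp_upto3 s * exp_upto3 t) (exp_upto3 (s + t))"
proof -
  define h x where "h = (fps_const (1/2) :: complex fps)" and "x = (fps_const (1/6) :: complex fps)"
  have hx: "2 * h = 1" "6 * x = 1" "h = 3 * x"
    unfolding h_def x_def by (simp_all add: fps_numeral_fps_const fps_const_mult)
  obtain a b where [simp]: "s = fps_X * a" "t = fps_X * b" using assms by (auto elim!: dvdE)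
  have id: "exp_upto3 s * exp_upto3 t = exp_upto3 (s + t) + (h * h * s ^ 2 * t ^ 2 + x * s * t ^ 3 + x * s ^ 3 * t
      + h * x * s ^ 2 * t ^ 3 + h * x * s ^ 3 * t ^ 2 + x * x * s ^ 3 * t ^ 3)"
    unfolding exp_upto3_def h_def[symmetric] x_def[symmetric] using hx by algebra
  have "exp_upto3 s * exp_upto3 t = exp_upto3 (s + t) + fps_X ^ 4 * (h * h * a ^ 2 * b ^ 2 + x * a * b ^ 3 + x * a ^ 3 * b
      + fps_X * (h * x * a ^ 2 * b ^ 3 + h * x * a ^ 3 * b ^ 2) + fps_X ^ 2 * (x * x * a ^ 3 * b ^ 3))"
    unfolding id by (simp only: \<open>s = _\<close> \<open>t = _\<close>) algebra
  then show ?thesis by (rule cong_X4I)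
qed

lemma exp_upto3_power:
  assumes "fps_X dvd s"
  shows "cong_X4 (exp_upto3 s ^ k) (exp_upto3 (of_nat k * s))"
proof (induction k)
  case (Suc k)
  have "cong_X4 (exp_upto3 s ^ Suc k) (exp_upto3 s * exp_upto3 (of_nat k * s))"
    unfolding power_Suc by (intro cong_X4_mult cong_X4_refl Suc)
  also have "cong_X4 \<dots> (exp_upto3 (s + of_nat k * s))"
    by (intro exp_upto3_add assms) (use assms in simp)
  also have "s + of_nat k * s = of_nat (Suc k) * s" by (simp add: algebra_simps)
  finally show ?case .
qed (simp add: exp_upto3_def)

text \<open>The lemma takes logarithms: writing \<open>f v = F0 exp (l1 v t + l2 v^2 t^2 + l3 v^3 t^3)\<close> up to
  \<open>O(t^4)\<close>, the product over all arguments is \<open>F0^(2 d)\<close> times the exponential of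
  \<open>l1 p1 t + l2 p2 t^2 + l3 p3 t^3\<close>, where \<open>p1\<close>, \<open>p2\<close>, \<open>p3\<close> are the power sums of the arguments.
  Here \<open>p1 = 0\<close>, and the equation for \<open>u\<close> says that \<open>p2 = 0\<close>.\<close>

lemma cubic_cancellation:
  fixes f :: "complex \<Rightarrow> complex fps"
  assumes f: "\<And>v. cong_X4 (f v) (F0 + fps_const v * fps_X * F1 + fps_const (v ^ 2) * fps_X ^ 2 * F2
        + fps_const (v ^ 3) * fps_X ^ 3 * F3)"
    and F0: "F0 $ 0 \<noteq> 0" and d: "d \<ge> 1" and u: "2 * u ^ 2 - 2 * u + of_nat d = 0"
    and l3: "l3 = F3 * inverse F0 - F1 * F2 * inverse F0 ^ 2 + fps_const (1/3) * F1 ^ 3 * inverse F0 ^ 3"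
  shows "cong_X4 (f (1 - of_nat d) * f 0 * (f u * f (1 - u)) ^ (d - 1))
     (F0 ^ (2 * d) + fps_X ^ 3 * (fps_const ((1 - of_nat d) ^ 3 + of_nat (d - 1) * (u ^ 3 + (1 - u) ^ 3)) * (F0 ^ (2 * d) * l3)))"
proof -
  define h x where "h = (fps_const (1/2) :: complex fps)" and "x = (fps_const (1/6) :: complex fps)"
  have hx: "2 * h = 1" "6 * x = 1" "fps_const (1/3) = 2 * x"
    unfolding h_def x_def by (simp_all add: fps_numeral_fps_const fps_const_mult)
  define i where "i = inverse F0"
  have i: "F0 * i = 1" using F0 unfolding i_def by (simp add: inverse_mult_eq_1')
  define l1 l2 where "l1 = F1 * i" and "l2 = F2 * i - h * (F1 * i) ^ 2"
  have l3': "l3 = F3 * i - F1 * F2 * i ^ 2 + 2 * x * F1 ^ 3 * i ^ 3"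
    unfolding l3 i_def[symmetric] hx(3) ..
  define s where "s v = fps_X * (fps_const v * l1 + fps_const (v ^ 2) * fps_X * l2 + fps_const (v ^ 3) * fps_X ^ 2 * l3)" for v
  have Xs: "fps_X dvd s v" for v by (simp add: s_def)
  have fs: "cong_X4 (f v) (F0 * exp_upto3 (s v))" for v
  proof -
    define V where "V = fps_const v"
    have V: "fps_const (v ^ 2) = V ^ 2" "fps_const (v ^ 3) = V ^ 3"
      by (simp_all add: V_def fps_const_power)
    define t where "t = V * fps_X"
    have s: "s v = t * l1 + t ^ 2 * l2 + t ^ 3 * l3"
      unfolding s_def V V_def[symmetric] t_def by algebra
    have "F0 * exp_upto3 (s v) = F0 * (1 + t * l1 + t ^ 2 * (l2 + h * l1 ^ 2) + t ^ 3 * (l3 + l1 * l2 + x * l1 ^ 3))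
       + t ^ 4 * (F0 * (h * (l2 ^ 2 + 2 * l1 * l3 + 2 * t * l2 * l3 + t ^ 2 * l3 ^ 2) +
         x * (3 * l1 ^ 2 * (l2 + t * l3) + 3 * l1 * t * (l2 + t * l3) ^ 2 + t ^ 2 * (l2 + t * l3) ^ 3)))" (is "_ = _ + _ * ?R")
      unfolding exp_upto3_def h_def[symmetric] x_def[symmetric] s using hx by algebra
    also have "F0 * (1 + t * l1 + t ^ 2 * (l2 + h * l1 ^ 2) + t ^ 3 * (l3 + l1 * l2 + x * l1 ^ 3)) =
       F0 + t * F1 + t ^ 2 * F2 + t ^ 3 * F3"
      unfolding l1_def l2_def l3' using i hx by algebra
    finally have "F0 * exp_upto3 (s v) = (F0 + fps_const v * fps_X * F1 + fps_const (v ^ 2) * fps_X ^ 2 * F2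
        + fps_const (v ^ 3) * fps_X ^ 3 * F3) + fps_X ^ 4 * (V ^ 4 * ?R)"
      unfolding V V_def[symmetric] unfolding t_def by (simp add: power_mult_distrib mult_ac)
    then show ?thesis using f cong_X4I cong_X4_sym cong_X4_trans by blast
  qed
  have "cong_X4 (f (1 - of_nat d) * f 0 * (f u * f (1 - u)) ^ (d - 1))
     ((F0 * exp_upto3 (s (1 - of_nat d))) * (F0 * exp_upto3 (s 0)) * ((F0 * exp_upto3 (s u)) * (F0 * exp_upto3 (s (1 - u)))) ^ (d - 1))"
    by (intro cong_X4_mult cong_X4_power fs)
  also have "\<dots> = F0 ^ (2 * d) * (exp_upto3 (s (1 - of_nat d)) * (exp_upto3 (s u) * exp_upto3 (s (1 - u))) ^ (d - 1))"
  proof -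
    have "F0 ^ (2 * d) = F0 * F0 * (F0 * F0) ^ (d - 1)"
      using d by (cases d) (simp_all add: power_mult power2_eq_square flip: power_mult_distrib)
    moreover have "exp_upto3 (s 0) = 1" by (simp add: s_def exp_upto3_def)
    ultimately show ?thesis by (simp add: power_mult_distrib mult_ac)
  qed
  also have "cong_X4 \<dots> (F0 ^ (2 * d) * (exp_upto3 (s (1 - of_nat d)) * exp_upto3 (of_nat (d - 1) * (s u + s (1 - u)))))"
    by (intro cong_X4_mult cong_X4_refl cong_X4_trans[OF cong_X4_power[OF exp_upto3_add] exp_upto3_power] Xs dvd_add)
  also have "cong_X4 \<dots> (F0 ^ (2 * d) * exp_upto3 (s (1 - of_nat d) + of_nat (d - 1) * (s u + s (1 - u))))"
    by (intro cong_X4_mult cong_X4_refl exp_upto3_add Xs dvd_add dvd_mult)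
  also have "s (1 - of_nat d) + of_nat (d - 1) * (s u + s (1 - u)) =
     fps_X ^ 3 * (fps_const ((1 - of_nat d) ^ 3 + of_nat (d - 1) * (u ^ 3 + (1 - u) ^ 3)) * l3)" (is "_ = fps_X ^ 3 * ?c")
  proof -
    have p1: "(1 - of_nat d) + of_nat (d - 1) * (u + (1 - u)) = 0"
      using d by (simp add: of_nat_diff)
    have p2: "(1 - of_nat d) ^ 2 + of_nat (d - 1) * (u ^ 2 + (1 - u) ^ 2) = 0"
      unfolding of_nat_diff[OF d] of_nat_1 using u by algebra
    have "s (1 - of_nat d) + of_nat (d - 1) * (s u + s (1 - u)) =
      fps_const ((1 - of_nat d) + of_nat (d - 1) * (u + (1 - u))) * fps_X * l1 +
      fps_const ((1 - of_nat d) ^ 2 + of_nat (d - 1) * (u ^ 2 + (1 - u) ^ 2)) * fps_X ^ 2 * l2 +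
      fps_const ((1 - of_nat d) ^ 3 + of_nat (d - 1) * (u ^ 3 + (1 - u) ^ 3)) * fps_X ^ 3 * l3"
      unfolding s_def fps_of_nat[symmetric]
      by (simp only: fps_const_add[symmetric] fps_const_mult[symmetric]) algebra
    then show ?thesis unfolding p1 p2 by simp
  qed
  also have "exp_upto3 (fps_X ^ 3 * ?c) = 1 + fps_X ^ 3 * ?c + fps_X ^ 4 * (h * fps_X ^ 2 * ?c ^ 2 + x * fps_X ^ 5 * ?c ^ 3)"
    unfolding exp_upto3_def h_def[symmetric] x_def[symmetric] by algebra
  finally have "cong_X4 (f (1 - of_nat d) * f 0 * (f u * f (1 - u)) ^ (d - 1))
     (F0 ^ (2 * d) * (1 + fps_X ^ 3 * ?c + fps_X ^ 4 * (h * fps_X ^ 2 * ?c ^ 2 + x * fps_X ^ 5 * ?c ^ 3)))" .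
  also have "cong_X4 \<dots> (F0 ^ (2 * d) * (1 + fps_X ^ 3 * ?c))"
    by (intro cong_X4_mult cong_X4_refl cong_X4I[OF refl])
  also have "F0 ^ (2 * d) * (1 + fps_X ^ 3 * ?c) = F0 ^ (2 * d) + fps_X ^ 3 * (fps_const ((1 - of_nat d) ^ 3 + of_nat (d - 1) * (u ^ 3 + (1 - u) ^ 3)) * (F0 ^ (2 * d) * l3))"
    by (simp add: algebra_simps)
  finally show ?thesis .
qed

section \<open>Expansion at a root of unity\<close>

text \<open>The indeterminate near the root of unity \<open>z\<close>, in the coordinate \<open>t\<close> with \<open>q = z e^t\<close>. This
  coordinate is chosen because powers \<open>q^(n v)\<close> with \<open>z^n = 1\<close> become \<open>e^(n v t)\<close>, which makes sense
  for every complex \<open>v\<close>.\<close>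

definition local_q :: "complex \<Rightarrow> complex fps" where
  "local_q z = fps_const z * fps_exp 1"

lemma fps_prod_nth0: "(\<Prod>x\<in>A. f x :: 'a::comm_ring_1 fps) $ 0 = (\<Prod>x\<in>A. f x $ 0)"
  by (induction A rule: infinite_finite_induct) simp_all

lemma fps_X_dvd_iff': "fps_X dvd (f :: complex fps) \<longleftrightarrow> f $ 0 = 0"
  by (cases "f = 0") (simp_all add: fps_dvd_iff Suc_le_eq subdegree_eq_0_iff flip: not_less)

lemma local_q_power: "local_q z ^ e = fps_const (z ^ e) * fps_exp (of_nat e)"
  by (simp add: local_q_def power_mult_distrib fps_const_power fps_exp_power_mult)

lemma local_q_power_nth_0 [simp]: "(local_q z ^ e) $ 0 = z ^ e"
  by (simp add: local_q_power)

lemma local_q_nth_0 [simp]: "local_q z $ 0 = z"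
  by (simp add: local_q_def)

lemma local_q_power_neq_1:
  assumes "e > 0" shows "local_q z ^ e \<noteq> 1"
proof
  assume "local_q z ^ e = 1"
  then have "(local_q z ^ e) $ 0 = 1" "(local_q z ^ e) $ 1 = 0" by simp_all
  then show False using assms by (simp add: local_q_power)
qed

text \<open>The value at 1 of the \<open>j\<close>-th iterate of the Euler operator \<open>X d/dX\<close>, that is \<open>j!\<close> times the
  coefficient of \<open>x^j\<close> in \<open>p(e^x)\<close>. The bound \<open>N\<close> replaces the degree to make the map linear.\<close>

definition euler_moment :: "nat \<Rightarrow> nat \<Rightarrow> 'a::comm_ring_1 poly \<Rightarrow> 'a" where
  "euler_moment N j p = (\<Sum>m\<le>N. of_nat (m ^ j) * coeff p m)"

lemma euler_moment_smult: "euler_moment N j (smult a p) = a * euler_moment N j p"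
  by (simp add: euler_moment_def sum_distrib_left mult_ac)

lemma euler_moment_0:
  assumes "degree p \<le> N" shows "euler_moment N 0 p = poly p 1"
proof -
  have "poly p 1 = (\<Sum>m\<le>N. coeff p m)"
    unfolding poly_altdef using assms
    by (simp, intro sum.mono_neutral_left) (auto simp: coeff_eq_0)
  then show ?thesis by (simp add: euler_moment_def)
qed

lemma fps_exp_cong_X4:
  "cong_X4 (fps_exp a) (1 + fps_const a * fps_X + fps_const (a ^ 2 / 2) * fps_X ^ 2 + fps_const (a ^ 3 / 6) * fps_X ^ 3)"
proof -
  have "fps_exp a = (1 + fps_const a * fps_X + fps_const (a ^ 2 / 2) * fps_X ^ 2 + fps_const (a ^ 3 / 6) * fps_X ^ 3)
     + fps_X ^ 4 * fps_shift 4 (fps_exp a)"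
  proof (rule fps_ext)
    fix n :: nat
    have *: "(1 + fps_const a * fps_X + fps_const (a ^ 2 / 2) * fps_X ^ 2 + fps_const (a ^ 3 / 6) * fps_X ^ 3
     + fps_X ^ 4 * fps_shift 4 (fps_exp a)) $ n = (if n = 0 then 1 else 0) + a * (if n = 1 then 1 else 0)
       + a ^ 2 / 2 * (if n = 2 then 1 else 0) + a ^ 3 / 6 * (if n = 3 then 1 else 0) + (if n < 4 then 0 else a ^ n / fact n)"
      by (simp add: fps_X_power_mult_nth fps_X_nth fps_X_power_nth)
    consider "n = 0" | "n = 1" | "n = 2" | "n = 3" | "n \<ge> 4" by linarith
    then show "fps_exp a $ n = (1 + fps_const a * fps_X + fps_const (a ^ 2 / 2) * fps_X ^ 2 + fps_const (a ^ 3 / 6) * fps_X ^ 3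
     + fps_X ^ 4 * fps_shift 4 (fps_exp a)) $ n"
      unfolding * by cases (simp_all add: fact_numeral)
  qed
  then show ?thesis by (rule cong_X4I)
qed

lemma poly_fps_exp_expansion:
  fixes P :: "complex fps poly"
  assumes "degree P \<le> N"
  shows "cong_X4 (poly P (fps_exp (a * v))) (euler_moment N 0 P +
     fps_const v * fps_X * (fps_const a * euler_moment N 1 P) +
     fps_const (v ^ 2) * fps_X ^ 2 * (fps_const (a ^ 2 / 2) * euler_moment N 2 P) +
     fps_const (v ^ 3) * fps_X ^ 3 * (fps_const (a ^ 3 / 6) * euler_moment N 3 P))"
proof -
  have "poly P (fps_exp (a * v)) = (\<Sum>m\<le>N. coeff P m * fps_exp (of_nat m * (a * v)))"
    unfolding poly_altdef fps_exp_power_mult using assms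
    by (intro sum.mono_neutral_left) (auto simp: coeff_eq_0)
  also have "cong_X4 \<dots> (\<Sum>m\<le>N. coeff P m * (1 + fps_const (of_nat m * (a * v)) * fps_X +
     fps_const ((of_nat m * (a * v)) ^ 2 / 2) * fps_X ^ 2 + fps_const ((of_nat m * (a * v)) ^ 3 / 6) * fps_X ^ 3))"
    by (intro cong_X4_sum cong_X4_mult cong_X4_refl fps_exp_cong_X4)
  also have "\<dots> = (\<Sum>m\<le>N. of_nat (m ^ 0) * coeff P m +
     fps_const v * fps_X * (fps_const a * (of_nat (m ^ 1) * coeff P m)) +
     fps_const (v ^ 2) * fps_X ^ 2 * (fps_const (a ^ 2 / 2) * (of_nat (m ^ 2) * coeff P m)) +
     fps_const (v ^ 3) * fps_X ^ 3 * (fps_const (a ^ 3 / 6) * (of_nat (m ^ 3) * coeff P m)))"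
  proof (rule sum.cong)
    fix m
    have "fps_const (of_nat m * (a * v)) = of_nat m * (fps_const a * fps_const v)"
      "fps_const ((of_nat m * (a * v)) ^ 2 / 2) = of_nat (m ^ 2) * (fps_const (a ^ 2 / 2) * fps_const (v ^ 2))"
      "fps_const ((of_nat m * (a * v)) ^ 3 / 6) = of_nat (m ^ 3) * (fps_const (a ^ 3 / 6) * fps_const (v ^ 3))"
      by (simp_all add: fps_of_nat[symmetric] fps_const_mult power_mult_distrib mult_ac del: of_nat_power)
    then show "coeff P m * (1 + fps_const (of_nat m * (a * v)) * fps_X +
       fps_const ((of_nat m * (a * v)) ^ 2 / 2) * fps_X ^ 2 + fps_const ((of_nat m * (a * v)) ^ 3 / 6) * fps_X ^ 3) =
       of_nat (m ^ 0) * coeff P m +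
     fps_const v * fps_X * (fps_const a * (of_nat (m ^ 1) * coeff P m)) +
     fps_const (v ^ 2) * fps_X ^ 2 * (fps_const (a ^ 2 / 2) * (of_nat (m ^ 2) * coeff P m)) +
     fps_const (v ^ 3) * fps_X ^ 3 * (fps_const (a ^ 3 / 6) * (of_nat (m ^ 3) * coeff P m))"
      by (simp add: algebra_simps del: of_nat_power fps_const_mult)
  qed simp
  finally show ?thesis
    by (simp add: euler_moment_def sum.distrib sum_distrib_left del: of_nat_power)
qed

definition residue_poly :: "complex fps poly \<Rightarrow> complex poly" where
  "residue_poly p = map_poly (\<lambda>f. f $ 0) p"

lemma coeff_residue_poly [simp]: "coeff (residue_poly p) m = coeff p m $ 0"
  by (simp add: residue_poly_def coeff_map_poly)

lemma residue_poly_mult: "residue_poly (p * r) = residue_poly p * residue_poly r"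
  by (intro poly_eqI) (simp add: coeff_mult fps_sum_nth)

lemma residue_poly_prod: "residue_poly (\<Prod>x\<in>A. f x) = (\<Prod>x\<in>A. residue_poly (f x))"
proof (induction A rule: infinite_finite_induct)
  case empty
  show ?case by (intro poly_eqI) (simp add: coeff_1)
next
  case (infinite A)
  then show ?case by (intro poly_eqI) (simp add: coeff_1)
qed (simp add: residue_poly_mult)

lemma residue_poly_linear: "residue_poly [:a, b:] = [:a $ 0, b $ 0:]"
  by (intro poly_eqI) (simp add: coeff_pCons split: nat.split)

lemma residue_term_poly:
  "residue_poly (term_poly (local_q z) (local_q z ^ d) M k) = term_poly z (z ^ d) M k"
  by (simp add: term_poly_def residue_poly_mult residue_poly_prod residue_poly_linear flip: power_mult)

lemma euler_moment_nth_0: "euler_moment N j p $ 0 = euler_moment N j (residue_poly p)"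
  by (simp add: euler_moment_def fps_sum_nth fps_of_nat[symmetric] del: of_nat_power)

lemma degree_term_poly: "k \<le> M \<Longrightarrow> degree (term_poly q Q M k) \<le> M"
proof -
  assume k: "k \<le> M"
  have "degree (\<Prod>i<k. [:1, - (q * Q ^ i):]) \<le> k"
    using degree_prod_sum_le[of "{..<k}" "\<lambda>i. [:1, - (q * Q ^ i):]"]
      sum_bounded_above[of "{..<k}" "\<lambda>i. degree [:1, - (q * Q ^ i):]" 1] by (auto simp: o_def intro: order.trans)
  moreover have "degree (\<Prod>i\<in>{k<..M}. [:- (Q ^ i), 1:]) \<le> M - k"
    using degree_prod_sum_le[of "{k<..M}" "\<lambda>i. [:- (Q ^ i), 1:]"] by (simp add: o_def)
  ultimately show ?thesis unfolding term_poly_def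
    using k degree_mult_le[of "\<Prod>i<k. [:1, - (q * Q ^ i):]" "\<Prod>i\<in>{k<..M}. [:- (Q ^ i), 1:]"] by linarith
qed

lemma fps_to_fls_prod: "fps_to_fls (\<Prod>x\<in>A. f x) = (\<Prod>x\<in>A. fps_to_fls (f x :: complex fps))"
  by (induction A rule: infinite_finite_induct) (simp_all add: fls_times_fps_to_fls)

lemma fps_to_fls_sum: "fps_to_fls (\<Sum>x\<in>A. f x) = (\<Sum>x\<in>A. fps_to_fls (f x :: complex fps))"
  by (induction A rule: infinite_finite_induct) simp_all

lemma fps_to_fls_poly_term_poly:
  "fps_to_fls (poly (term_poly q Q M k) c) =
   poly (term_poly (fps_to_fls q) (fps_to_fls Q) M k) (fps_to_fls (c :: complex fps))"
  by (simp add: poly_term_poly fls_times_fps_to_fls fps_to_fls_prod fps_to_fls_power)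

section \<open>Fourth-order vanishing at primitive roots\<close>

lemma terminating_index:
  fixes d r n :: nat
  assumes d: "d \<ge> 2" and r: "r > 0" and n: "n + 1 = d * r"
  shows "d * ((d - 1) * r - 1) + 1 = (d - 1) * n"
proof -
  obtain e where e: "d = Suc e" using d by (cases d) auto
  have "(d - 1) * r > 0" using d r by simp
  then have "d * ((d - 1) * r - 1) + d = d * ((d - 1) * r)" by (cases "(d - 1) * r") simp_all
  also have "\<dots> = (d - 1) * (n + 1)" unfolding n by simp
  finally show ?thesis using e by simp
qed

lemma coprime_if_Suc_eq_mult:
  fixes d r n :: nat
  assumes n: "n + 1 = d * r"
  shows "coprime n d"
proof (rule coprimeI)
  fix c assume "c dvd n" "c dvd d"
  then have "c dvd n" "c dvd n + 1" unfolding n by auto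
  then show "is_unit c" using dvd_add_right_iff by blast
qed

locale full_order_root =
  fixes z :: complex and n d r M :: nat
  assumes prim: "\<And>i. z ^ i = 1 \<longleftrightarrow> n dvd i" and d: "d \<ge> 3" and r: "r > 0" and n: "n + 1 = d * r"
    and M: "M = (d - 1) * r - 1"
begin

lemma dM: "d * M + 1 = (d - 1) * n"
  using terminating_index[OF _ r n] d M by simp

lemma M_less: "M < n"
proof -
  have "d * r = (d - 1) * r + r" using d by (cases d) auto
  moreover have "1 * 1 \<le> (d - 1) * r" by (rule mult_le_mono) (use d r in auto)
  ultimately show ?thesis using n M r by linarith
qed

lemma coprime_nd: "coprime n d"
  using n by (rule coprime_if_Suc_eq_mult)

lemma z_nonzero: "z \<noteq> 0"
proof
  assume "z = 0"
  then have "z ^ n \<noteq> 1" using M_less by (simp add: power_0_left)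
  then show False using prim[of n] by simp
qed

text \<open>The identity \<open>vanishing_sum\<close> in the field of Laurent series: \<open>Q^(-M) / q = q^(-(d-1)n)\<close>
  because \<open>d M + 1 = (d - 1) n\<close>, and \<open>Q^r / q = q^n\<close>. The factors that must not vanish have nonzero constant
  coefficient.\<close>

lemma local_vanishing:
  defines "q \<equiv> local_q z"
  shows "(\<Sum>k\<le>M. (1 - q * (q ^ d) ^ (2 * k)) * (q ^ d) ^ ((d - 2) * k) *
      (poly (term_poly q (q ^ d) M k) (fps_exp (of_nat n * (1 - of_nat d))) *
       poly (term_poly q (q ^ d) M k) (fps_exp (of_nat n * 0)) *
       (poly (term_poly q (q ^ d) M k) (fps_exp (of_nat n * u)) *
        poly (term_poly q (q ^ d) M k) (fps_exp (of_nat n * (1 - u)))) ^ (d - 1))) = 0"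
proof -
  define E where "E v = fps_to_fls (fps_exp (of_nat n * v :: complex))" for v
  define q' where "q' = fps_to_fls q"
  have qpow: "fps_to_fls (q ^ e) = q' ^ e" for e by (simp add: q'_def fps_to_fls_power)
  have q'1: "q' ^ e \<noteq> 1" if "e > 0" for e
    using local_q_power_neq_1[OF that, of z] unfolding qpow[symmetric] q_def by simp
  have q'0: "q' \<noteq> 0" using z_nonzero by (simp add: q'_def q_def local_q_def)
  have ex: "fps_exp (of_nat k) = q ^ k" if "n dvd k" for k
    using prim[of k] that by (simp add: q_def local_q_power)
  have nth: "(q ^ d) ^ i $ 0 = z ^ (d * i)" for i by (simp add: q_def flip: power_mult)
  have ne: "fps_exp a \<noteq> (q ^ d) ^ i" if "i \<in> {0<..M}" for i a
  proof
    assume "fps_exp a = (q ^ d) ^ i"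
    then have "z ^ (d * i) = 1" using nth[of i] by (metis fps_exp_nth div_by_1 fact_0 of_nat_1 power_0)
    then have "n dvd i" using prim coprime_nd by (simp add: coprime_dvd_mult_right_iff)
    then show False using that M_less by (auto dest: dvd_imp_le)
  qed
  have ne': "q * fps_exp a \<noteq> (q ^ d) ^ i" if i: "i \<in> {0<..<r}" for i a
  proof
    assume "q * fps_exp a = (q ^ d) ^ i"
    then have "(q * fps_exp a) $ 0 = z ^ (d * i)" using nth by metis
    then have "z * z ^ (d * i - 1) = z * 1" using i d by (simp add: q_def flip: power_Suc)
    then have "z ^ (d * i - 1) = 1" using z_nonzero by (metis mult_left_cancel)
    then have "n dvd d * i - 1" using prim by simp
    moreover have "d * i - 1 > 0"
    proof -
      have "d * i \<ge> 3 * 1" using i d by (intro mult_le_mono) auto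
      then show ?thesis by simp
    qed
    moreover have "d * i - 1 < n"
    proof -
      have "d * i \<le> d * (r - 1)" using i by (intro mult_le_mono2) auto
      also have "\<dots> = n + 1 - d" unfolding n by (simp add: diff_mult_distrib2)
      finally show ?thesis using d \<open>d * i - 1 > 0\<close> by linarith
    qed
    ultimately show False by (auto dest: dvd_imp_le)
  qed
  interpret well_poised q' "q' ^ d" M
  proof
    show "q' \<noteq> 0" "q' ^ d \<noteq> 0" using q'0 by auto
    show "(q' ^ d) ^ i \<noteq> 1" if "0 < i" for i
      using q'1[of "d * i"] d that by (simp add: power_mult)
    show "q' * (q' ^ d) ^ i \<noteq> 1" for i
      using q'1[of "Suc (d * i)"] by (simp add: power_mult)
  qed
  have "E u * E (1 - u) = fps_to_fls (fps_exp (of_nat n * u) * fps_exp (of_nat n * (1 - u)))"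
    by (simp add: E_def fls_times_fps_to_fls)
  also have "fps_exp (of_nat n * u) * fps_exp (of_nat n * (1 - u)) = (fps_exp (of_nat n) :: complex fps)"
    by (simp add: algebra_simps flip: fps_exp_add_mult)
  also have "fps_to_fls \<dots> = q' ^ n" by (simp add: ex qpow)
  also have "\<dots> = (q' ^ d) ^ r / q'"
    using q'0 by (simp add: n[symmetric] flip: power_mult)
  finally have cc: "E u * E (1 - u) = (q' ^ d) ^ r / q'" .
  have "fps_exp (of_nat n * (1 - of_nat d)) * q ^ (d * M + 1) = (1 :: complex fps)"
  proof -
    have "of_nat n * (1 - of_nat d) + of_nat ((d - 1) * n) = (0 :: complex)"
      using d by (simp add: of_nat_diff algebra_simps)
    then have "fps_exp (of_nat n * (1 - of_nat d)) * fps_exp (of_nat ((d - 1) * n)) = (1 :: complex fps)"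
      unfolding fps_exp_add_mult[symmetric] by (simp only: fps_exp_0)
    then show ?thesis unfolding dM ex[OF dvd_triv_right] .
  qed
  then have "E (1 - of_nat d) * q' ^ (d * M + 1) = 1"
    unfolding E_def qpow[symmetric] fls_times_fps_to_fls[symmetric] by simp
  then have c1: "inverse (q' ^ d) ^ M / q' = E (1 - of_nat d)"
    using q'0 by (simp add: field_simps power_inverse flip: power_mult)
  have nz1: "E u \<noteq> (q' ^ d) ^ i \<and> E (1 - u) \<noteq> (q' ^ d) ^ i" if "i \<in> {0<..M}" for i
    using ne[OF that] unfolding E_def q'_def fps_to_fls_power[symmetric] by simp
  have nz2: "q' * E u \<noteq> (q' ^ d) ^ i \<and> q' * E (1 - u) \<noteq> (q' ^ d) ^ i" if "i \<in> {0<..<r}" for i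
    using ne'[OF that] unfolding E_def q'_def fps_to_fls_power[symmetric] fls_times_fps_to_fls[symmetric] by simp
  have E0: "1 = E 0" by (simp add: E_def)
  have hom: "fps_to_fls (poly (term_poly q (q ^ d) M k) (fps_exp (of_nat n * v))) = poly (term_poly q' (q' ^ d) M k) (E v)" for k v
    by (simp add: fps_to_fls_poly_term_poly E_def q'_def fps_to_fls_power)
  have "(\<Sum>k\<le>M. (1 - q' * (q' ^ d) ^ (2 * k)) * (q' ^ d) ^ ((d - 2) * k) *
           (poly (term_poly q' (q' ^ d) M k) (E (1 - of_nat d)) * poly (term_poly q' (q' ^ d) M k) (E 0) *
            (poly (term_poly q' (q' ^ d) M k) (E u) * poly (term_poly q' (q' ^ d) M k) (E (1 - u))) ^ (d - 1))) = 0"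
    using vanishing_sum[OF d r M refl cc nz1 nz2] unfolding c1 E0 by simp
  then have "fps_to_fls (\<Sum>k\<le>M. (1 - q * (q ^ d) ^ (2 * k)) * (q ^ d) ^ ((d - 2) * k) *
      (poly (term_poly q (q ^ d) M k) (fps_exp (of_nat n * (1 - of_nat d))) *
       poly (term_poly q (q ^ d) M k) (fps_exp (of_nat n * 0)) *
       (poly (term_poly q (q ^ d) M k) (fps_exp (of_nat n * u)) *
        poly (term_poly q (q ^ d) M k) (fps_exp (of_nat n * (1 - u)))) ^ (d - 1))) = 0"
    unfolding fps_to_fls_sum fls_times_fps_to_fls fps_to_fls_power fps_to_fls_minus hom
    by (simp add: q'_def fps_to_fls_power)
  then show ?thesis by (simp only: fps_to_fls_eq_0_iff)
qed

text \<open>The functional \<open>H\<close> below is the constant coefficient of the cubic term supplied by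
  \<open>cubic_cancellation\<close>. It is homogeneous since the logarithmic coefficient depends only on ratios
  of Taylor coefficients.\<close>

lemma fourth_order_vanishing:
  defines "q \<equiv> local_q z"
  shows "fps_X ^ 4 dvd (\<Sum>k\<le>M. (1 - q * (q ^ d) ^ (2 * k)) * (q ^ d) ^ ((d - 2) * k) *
      poly (term_poly q (q ^ d) M k) 1 ^ (2 * d))"
proof -
  define w where "w k = (1 - q * (q ^ d) ^ (2 * k)) * (q ^ d) ^ ((d - 2) * k)" for k
  define T where "T k = term_poly q (q ^ d) M k" for k
  \<comment> \<open>This root makes the sum of the squares of the exponents vanish.\<close>
  define u where "u = (1 + csqrt (1 - 2 * of_nat d)) / 2"
  have u: "2 * u ^ 2 - 2 * u + of_nat d = 0"
  proof -
    have "csqrt (1 - 2 * of_nat d) ^ 2 = 1 - 2 * of_nat d" by simp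
    moreover have "csqrt (1 - 2 * of_nat d) = 2 * u - 1" by (simp add: u_def)
    ultimately have "(2 * u - 1) ^ 2 = 1 - 2 * of_nat d" by simp
    then show ?thesis by algebra
  qed
  define F where "F j k = fps_const (of_nat n ^ j / fact j) * euler_moment M j (T k)" for j k
  define L where "L k = F 3 k * inverse (F 0 k) - F 1 k * F 2 k * inverse (F 0 k) ^ 2 +
     fps_const (1/3) * F 1 k ^ 3 * inverse (F 0 k) ^ 3" for k
  define H where "H p = euler_moment M 0 p ^ (2 * d) *
     (of_nat n ^ 3 / 6 * euler_moment M 3 p * inverse (euler_moment M 0 p)
      - (of_nat n * euler_moment M 1 p) * (of_nat n ^ 2 / 2 * euler_moment M 2 p) * inverse (euler_moment M 0 p) ^ 2
      + 1 / 3 * (of_nat n * euler_moment M 1 p) ^ 3 * inverse (euler_moment M 0 p) ^ 3)" for p :: "complex poly"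
  define C where "C = fps_const ((1 - of_nat d :: complex) ^ 3 + of_nat (d - 1) * (u ^ 3 + (1 - u) ^ 3))"
  have deg: "degree (T k) \<le> M" if "k \<le> M" for k using degree_term_poly[OF that] by (simp add: T_def)
  have F0: "F 0 k = poly (T k) 1" if "k \<le> M" for k
    using euler_moment_0[OF deg[OF that]] by (simp add: F_def)
  have F0_nz: "F 0 k $ 0 \<noteq> 0" if k: "k \<le> M" for k
  proof -
    have 1: "1 - z * (z ^ d) ^ i \<noteq> 0" if "i < k" for i
    proof
      assume "1 - z * (z ^ d) ^ i = 0"
      then have "z ^ (d * i + 1) = 1" by (simp add: power_mult)
      then have "n dvd d * i + 1" using prim by blast
      moreover have "n dvd d * M + 1" unfolding dM by simp
      ultimately have "n dvd (d * M + 1) - (d * i + 1)" by (rule dvd_diff_nat[rotated])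
      also have "(d * M + 1) - (d * i + 1) = d * (M - i)" by (simp add: diff_mult_distrib2)
      finally have "n dvd M - i" using coprime_nd by (simp add: coprime_dvd_mult_right_iff)
      then show False using that k M_less by (auto dest: dvd_imp_le)
    qed
    have 2: "1 - (z ^ d) ^ i \<noteq> 0" if "i \<in> {k<..M}" for i
    proof
      assume "1 - (z ^ d) ^ i = 0"
      then have "n dvd d * i" using prim[of "d * i"] by (simp add: power_mult)
      then have "n dvd i" using coprime_nd by (simp add: coprime_dvd_mult_right_iff)
      then show False using that M_less by (auto dest: dvd_imp_le)
    qed
    have "F 0 k $ 0 = poly (term_poly z (z ^ d) M k) 1"
      unfolding F0[OF k] T_def poly_term_poly q_def
      by (simp add: fps_mult_nth_0 fps_prod_nth0 flip: power_mult)
    then show ?thesis using 1 2 by (simp add: poly_term_poly)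
  qed
  have eu: "cong_X4 (poly (T k) (fps_exp (of_nat n * (1 - of_nat d))) * poly (T k) (fps_exp (of_nat n * 0)) *
      (poly (T k) (fps_exp (of_nat n * u)) * poly (T k) (fps_exp (of_nat n * (1 - u)))) ^ (d - 1))
     (F 0 k ^ (2 * d) + fps_X ^ 3 * (C * (F 0 k ^ (2 * d) * L k)))" if k: "k \<le> M" for k
    unfolding C_def
  proof (rule cubic_cancellation[where f = "\<lambda>v. poly (T k) (fps_exp (of_nat n * v))" and ?F1.0 = "F 1 k" and ?F2.0 = "F 2 k" and ?F3.0 = "F 3 k"])
    show "cong_X4 (poly (T k) (fps_exp (of_nat n * v))) (F 0 k + fps_const v * fps_X * F 1 k +
           fps_const (v ^ 2) * fps_X ^ 2 * F 2 k + fps_const (v ^ 3) * fps_X ^ 3 * F 3 k)" for v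
      using poly_fps_exp_expansion[OF deg[OF k], of "of_nat n" v] by (simp add: F_def fact_numeral)
    show "F 0 k $ 0 \<noteq> 0" by (rule F0_nz[OF k])
    show "1 \<le> d" using d by simp
  qed (use u in \<open>simp_all add: L_def\<close>)
  have "cong_X4 (\<Sum>k\<le>M. w k * (poly (T k) (fps_exp (of_nat n * (1 - of_nat d))) * poly (T k) (fps_exp (of_nat n * 0)) *
      (poly (T k) (fps_exp (of_nat n * u)) * poly (T k) (fps_exp (of_nat n * (1 - u)))) ^ (d - 1)))
     (\<Sum>k\<le>M. w k * (F 0 k ^ (2 * d) + fps_X ^ 3 * (C * (F 0 k ^ (2 * d) * L k))))"
    by (intro cong_X4_sum cong_X4_mult cong_X4_refl eu) simp
  then have "cong_X4 0 (\<Sum>k\<le>M. w k * (F 0 k ^ (2 * d) + fps_X ^ 3 * (C * (F 0 k ^ (2 * d) * L k))))"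
    unfolding w_def T_def q_def local_vanishing[of u] .
  also have "(\<Sum>k\<le>M. w k * (F 0 k ^ (2 * d) + fps_X ^ 3 * (C * (F 0 k ^ (2 * d) * L k)))) =
     (\<Sum>k\<le>M. w k * F 0 k ^ (2 * d)) + fps_X ^ 3 * (C * (\<Sum>k\<le>M. w k * (F 0 k ^ (2 * d) * L k)))"
    unfolding sum_distrib_left sum.distrib[symmetric] by (rule sum.cong) (simp_all only: distrib_left mult_ac)
  finally have e: "cong_X4 0 \<dots>" .
  have "(\<Sum>k\<le>M. w k * (F 0 k ^ (2 * d) * L k)) $ 0 = 0"
  proof -
    have Fnth: "F j k $ 0 = of_nat n ^ j / fact j * euler_moment M j (term_poly z (z ^ d) M k)" for j k
      by (simp add: F_def T_def q_def euler_moment_nth_0 residue_term_poly)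
    have "(\<Sum>k\<le>M. w k * (F 0 k ^ (2 * d) * L k)) $ 0 =
      (\<Sum>k\<le>M. (1 - z * (z ^ d) ^ (2 * k)) * (z ^ d) ^ ((d - 2) * k) * H (term_poly z (z ^ d) M k))"
      unfolding fps_sum_nth
    proof (rule sum.cong)
      fix k
      have "w k $ 0 = (1 - z * (z ^ d) ^ (2 * k)) * (z ^ d) ^ ((d - 2) * k)"
        by (simp add: w_def q_def flip: power_mult)
      moreover have "(F 0 k ^ (2 * d) * L k) $ 0 = H (term_poly z (z ^ d) M k)"
        unfolding L_def H_def fps_mult_nth_0 fps_add_nth fps_sub_nth fps_power_zeroth fps_inverse_nth_0 Fnth
        by (simp add: fact_numeral)
      ultimately show "(w k * (F 0 k ^ (2 * d) * L k)) $ 0 =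
        (1 - z * (z ^ d) ^ (2 * k)) * (z ^ d) ^ ((d - 2) * k) * H (term_poly z (z ^ d) M k)"
        by (simp only: fps_mult_nth_0)
    qed simp
    also have "\<dots> = 0"
    proof (rule antisymmetric_sum)
      have "z ^ (d * M + 1) = 1" using prim unfolding dM by simp
      then show "z * (z ^ d) ^ M = 1" by (simp add: power_mult)
      show "2 \<le> d" using d by simp
      show "H (smult a p) = a ^ (2 * d) * H p" if "a \<noteq> 0" for a p
      proof -
        have br: "A * (a * x3) * (b * i) - (N * (a * x1)) * (B * (a * x2)) * (b * i) ^ 2 + E * (N * (a * x1)) ^ 3 * (b * i) ^ 3
            = A * x3 * i - (N * x1) * (B * x2) * i ^ 2 + E * (N * x1) ^ 3 * i ^ 3"
          if "a * b = 1" for A B E N b i x1 x2 x3 :: complex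
          using that by algebra
        show ?thesis
          unfolding H_def euler_moment_smult inverse_mult_distrib power_mult_distrib[of a _ "2 * d"]
            br[OF right_inverse[OF that]] by (simp only: mult.assoc)
      qed
    qed simp
    finally show ?thesis .
  qed
  then have "fps_X dvd (\<Sum>k\<le>M. w k * (F 0 k ^ (2 * d) * L k))"
    by (simp add: fps_X_dvd_iff')
  then have "fps_X ^ 3 * fps_X dvd fps_X ^ 3 * (C * (\<Sum>k\<le>M. w k * (F 0 k ^ (2 * d) * L k)))"
    by (intro mult_dvd_mono dvd_refl dvd_mult)
  then have "cong_X4 ((\<Sum>k\<le>M. w k * F 0 k ^ (2 * d)) + fps_X ^ 3 * (C * (\<Sum>k\<le>M. w k * (F 0 k ^ (2 * d) * L k)))) (\<Sum>k\<le>M. w k * F 0 k ^ (2 * d))"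
    by (simp add: cong_X4_def power_Suc2[symmetric] del: power_Suc)
  from cong_X4_trans[OF e this] have "fps_X ^ 4 dvd (\<Sum>k\<le>M. w k * F 0 k ^ (2 * d))"
    by (simp add: cong_X4_def)
  then show ?thesis using F0 by (simp add: w_def T_def)
qed

end

section \<open>Vanishing at roots of smaller order\<close>

lemma fps_dvd_X: "(f :: complex fps) $ 1 \<noteq> 0 \<Longrightarrow> f dvd fps_X"
  by (subst fps_dvd_iff) (auto intro!: subdegree_leI)

lemma qpochhammer_add: "qpochhammer a q (k + i) = qpochhammer a q k * (\<Prod>j<i. 1 - a * q ^ (k + j))"
  by (induction i) (simp_all add: qpochhammer_def mult_ac)

locale root_block =
  fixes z :: complex and m d s :: nat
  assumes prim: "\<And>i. z ^ i = 1 \<longleftrightarrow> m dvd i" and m: "m > 1" and d: "d \<ge> 2"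
    and coprime: "coprime m d" and s: "s < m" "m dvd d * s + 1"
begin

definition base :: "complex fps" where "base = local_q z"
definition ratio :: "nat \<Rightarrow> complex fps" where
  "ratio k = qpochhammer base (base ^ d) k div qpochhammer (base ^ d) (base ^ d) k"
definition summand :: "nat \<Rightarrow> complex fps" where
  "summand k = (1 - base * (base ^ d) ^ (2 * k)) * (base ^ d) ^ ((d - 2) * k) * ratio k ^ (2 * d)"

lemma numerator_nth_0: "(1 - base * (base ^ d) ^ k) $ 0 = 1 - z ^ (d * k + 1)"
  by (simp add: base_def fps_power_zeroth power_mult)

lemma denominator_nth_0: "(1 - base ^ d * (base ^ d) ^ k) $ 0 = 1 - z ^ (d * (k + 1))"
  by (simp add: base_def fps_power_zeroth power_mult power_add)

lemma power_mod_eq: "i mod m = j mod m \<Longrightarrow> z ^ i = z ^ j"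
proof -
  have e: "z ^ i = z ^ (i mod m)" for i
  proof -
    have "z ^ i = z ^ (m * (i div m) + i mod m)" by simp
    also have "\<dots> = z ^ (i mod m)" using prim[of "m * (i div m)"] unfolding power_add by simp
    finally show ?thesis .
  qed
  show "i mod m = j mod m \<Longrightarrow> z ^ i = z ^ j" using e[of i] e[of j] by simp
qed

lemma numerator_nth_0_block: "(1 - base * (base ^ d) ^ (j * m + k)) $ 0 = (1 - base * (base ^ d) ^ k) $ 0"
proof -
  have "(d * (j * m + k) + 1) mod m = ((d * k + 1) + (d * j) * m) mod m" by (simp add: algebra_simps)
  then have "(d * (j * m + k) + 1) mod m = (d * k + 1) mod m" by simp
  from power_mod_eq[OF this] show ?thesis unfolding numerator_nth_0 by simp
qed

lemma denominator_nth_0_block: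
  "(1 - base ^ d * (base ^ d) ^ (j * m + k)) $ 0 = (1 - base ^ d * (base ^ d) ^ k) $ 0"
proof -
  have "(d * (j * m + k + 1)) mod m = (d * (k + 1) + (d * j) * m) mod m" by (simp add: algebra_simps)
  then have "(d * (j * m + k + 1)) mod m = (d * (k + 1)) mod m" by simp
  from power_mod_eq[OF this] show ?thesis unfolding denominator_nth_0 by simp
qed

lemma denominator_nonzero: "k + 1 < m \<Longrightarrow> (1 - base ^ d * (base ^ d) ^ k) $ 0 \<noteq> 0"
proof
  assume k: "k + 1 < m" "(1 - base ^ d * (base ^ d) ^ k) $ 0 = 0"
  then have "m dvd d * (k + 1)" unfolding denominator_nth_0 prim[symmetric] by simp
  then have "m dvd k + 1" using coprime_dvd_mult_right_iff[OF coprime] by blast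
  then show False using k by (auto dest: dvd_imp_le)
qed

lemma numerator_zero: "(1 - base * (base ^ d) ^ s) $ 0 = 0"
  using s(2) unfolding numerator_nth_0 prim[symmetric] by simp

lemma qpochhammer_nonzero: "qpochhammer (base ^ d) (base ^ d) k \<noteq> 0"
proof -
  have "1 - base ^ d * (base ^ d) ^ i \<noteq> 0" for i
    using local_q_power_neq_1[of "d * Suc i" z] d by (simp add: base_def power_mult power_add)
  then show ?thesis by (simp add: qpochhammer_def)
qed

lemma block_denominator_unit:
  assumes "k < m" shows "(\<Prod>i<k. 1 - base ^ d * (base ^ d) ^ (j * m + i)) $ 0 \<noteq> 0"
  unfolding fps_prod_nth0 denominator_nth_0_block using assms denominator_nonzero by auto

text \<open>Among \<open>m\<close> consecutive factors exactly one of the denominator vanishes at \<open>t = 0\<close>, and it vanishes to first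
  order; at least one of the numerator vanishes too.\<close>

lemma qpochhammer_block_dvd:
  "qpochhammer (base ^ d) (base ^ d) (j * m) dvd qpochhammer base (base ^ d) (j * m)"
proof (induction j)
  case (Suc j)
  let ?A = "\<Prod>i<m. 1 - base * (base ^ d) ^ (j * m + i)" and ?D = "\<Prod>i<m. 1 - base ^ d * (base ^ d) ^ (j * m + i)"
  let ?U = "\<Prod>i<m - 1. 1 - base ^ d * (base ^ d) ^ (j * m + i)"
  have "?A $ 0 = 0"
    unfolding fps_prod_nth0 numerator_nth_0_block using s(1) numerator_zero by (auto intro: prod_zero)
  then have A: "fps_X dvd ?A" by (simp add: fps_X_dvd_iff')
  have last: "base ^ d * (base ^ d) ^ (j * m + (m - 1)) = fps_exp (of_nat (d * (Suc j * m)))"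
  proof -
    have "base ^ d * (base ^ d) ^ (j * m + (m - 1)) = base ^ (d * Suc (j * m + (m - 1)))"
      by (simp only: power_mult power_Suc)
    also have "Suc (j * m + (m - 1)) = Suc j * m" using m by simp
    also have "base ^ (d * (Suc j * m)) = fps_exp (of_nat (d * (Suc j * m)))"
      using prim[of "d * (Suc j * m)"] unfolding base_def local_q_power by simp
    finally show ?thesis .
  qed
  have "{..<m} = insert (m - 1) {..<m - 1}" using m by auto
  then have D: "?D = (1 - base ^ d * (base ^ d) ^ (j * m + (m - 1))) * ?U" by simp
  have "?D $ 1 = - of_nat (d * (Suc j * m)) * ?U $ 0"
    unfolding D last using fps_mult_nth_1 by simp
  also have "\<dots> \<noteq> 0" using block_denominator_unit[of "m - 1" j] m d by (auto simp del: of_nat_mult of_nat_Suc mult_Suc)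
  finally have "?D $ 1 \<noteq> 0" .
  then have "?D dvd fps_X" by (rule fps_dvd_X)
  with A have "?D dvd ?A" by (rule dvd_trans[rotated])
  with Suc have "qpochhammer (base ^ d) (base ^ d) (j * m) * ?D dvd qpochhammer base (base ^ d) (j * m) * ?A"
    by (rule mult_dvd_mono)
  then show ?case using qpochhammer_add[of base "base ^ d" "j * m" m] qpochhammer_add[of "base ^ d" "base ^ d" "j * m" m]
    by (simp add: add.commute)
qed (simp add: qpochhammer_def)

lemma qpochhammer_dvd: "qpochhammer (base ^ d) (base ^ d) k dvd qpochhammer base (base ^ d) k"
proof -
  define j i where "j = k div m" and "i = k mod m"
  have k: "k = j * m + i" and i: "i < m" using m by (simp_all add: j_def i_def)
  have "is_unit (\<Prod>l<i. 1 - base ^ d * (base ^ d) ^ (j * m + l))"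
    using block_denominator_unit[OF i] by (simp add: fps_is_unit_iff)
  then have "(\<Prod>l<i. 1 - base ^ d * (base ^ d) ^ (j * m + l)) dvd (\<Prod>l<i. 1 - base * (base ^ d) ^ (j * m + l))"
    by (rule unit_imp_dvd)
  then show ?thesis unfolding k qpochhammer_add by (intro mult_dvd_mono qpochhammer_block_dvd)
qed

lemma ratio_mult: "ratio k * qpochhammer (base ^ d) (base ^ d) k = qpochhammer base (base ^ d) k"
  using qpochhammer_dvd by (simp add: ratio_def)

lemma ratio_add:
  "ratio (k + i) * (\<Prod>j<i. 1 - base ^ d * (base ^ d) ^ (k + j)) = ratio k * (\<Prod>j<i. 1 - base * (base ^ d) ^ (k + j))"
proof -
  have "(ratio (k + i) * (\<Prod>j<i. 1 - base ^ d * (base ^ d) ^ (k + j))) * qpochhammer (base ^ d) (base ^ d) k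
      = ratio (k + i) * qpochhammer (base ^ d) (base ^ d) (k + i)"
    by (simp add: qpochhammer_add mult_ac)
  also have "\<dots> = (ratio k * qpochhammer (base ^ d) (base ^ d) k) * (\<Prod>j<i. 1 - base * (base ^ d) ^ (k + j))"
    unfolding ratio_mult by (simp add: qpochhammer_add)
  finally show ?thesis using qpochhammer_nonzero[of k] by (simp add: mult_ac)
qed

lemma ratio_0: "ratio 0 = 1"
  using ratio_mult[of 0] by (simp add: qpochhammer_def)

lemma ratio_block:
  assumes "i < m" shows "ratio (j * m + i) $ 0 = ratio (j * m) $ 0 * ratio i $ 0"
proof -
  let ?A = "(\<Prod>l<i. 1 - base * (base ^ d) ^ l) $ 0" and ?B = "(\<Prod>l<i. 1 - base ^ d * (base ^ d) ^ l) $ 0"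
  have B: "?B \<noteq> 0" using block_denominator_unit[OF assms, of 0] by simp
  have 1: "ratio (j * m + i) $ 0 * ?B = ratio (j * m) $ 0 * ?A"
    using arg_cong[OF ratio_add[of "j * m" i], of "\<lambda>f. f $ 0"]
    unfolding fps_mult_nth_0 fps_prod_nth0 numerator_nth_0_block denominator_nth_0_block .
  have 2: "ratio i $ 0 * ?B = ?A"
    using arg_cong[OF ratio_add[of 0 i], of "\<lambda>f. f $ 0"] by (simp add: ratio_0)
  have "ratio (j * m + i) $ 0 * ?B = (ratio (j * m) $ 0 * ratio i $ 0) * ?B"
    unfolding 1 2[symmetric] by simp
  then show ?thesis using B by simp
qed

lemma ratio_nth_0_eq_0:
  assumes "s < i" "i < m" shows "ratio i $ 0 = 0"
proof -
  have "ratio i $ 0 * (\<Prod>l<i. 1 - base ^ d * (base ^ d) ^ l) $ 0 = (\<Prod>l<i. 1 - base * (base ^ d) ^ l) $ 0"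
    using arg_cong[OF ratio_add[of 0 i], of "\<lambda>f. f $ 0"] by (simp add: ratio_0)
  also have "\<dots> = 0" unfolding fps_prod_nth0 using assms numerator_zero by (auto intro!: prod_zero)
  finally show ?thesis using block_denominator_unit[OF assms(2), of 0] by simp
qed

lemma ratio_term_poly:
  assumes "k \<le> s"
  shows "ratio k * qpochhammer (base ^ d) (base ^ d) s = poly (term_poly base (base ^ d) s k) 1"
proof -
  have e: "qpochhammer (base ^ d) (base ^ d) s = qpochhammer (base ^ d) (base ^ d) k * (\<Prod>i\<in>{k<..s}. 1 - (base ^ d) ^ i)"
  proof -
    have "(\<Prod>i\<in>{k<..s}. 1 - (base ^ d) ^ i) = (\<Prod>i<s - k. 1 - base ^ d * (base ^ d) ^ (k + i))"
      by (rule prod.reindex_bij_witness[of _ "\<lambda>i. k + i + 1" "\<lambda>i. i - k - 1"])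
        (auto simp del: power_Suc simp flip: power_Suc)
    then show ?thesis using qpochhammer_add[of "base ^ d" "base ^ d" k "s - k"] assms by simp
  qed
  show ?thesis unfolding e mult.assoc[symmetric] ratio_mult
    by (simp add: poly_term_poly qpochhammer_def)
qed

lemma summand_block:
  assumes "i < m" shows "summand (j * m + i) $ 0 = (ratio (j * m) $ 0) ^ (2 * d) * summand i $ 0"
proof -
  have p: "z ^ (d * (2 * (j * m + i)) + 1) = z ^ (d * (2 * i) + 1)"
  proof (rule power_mod_eq)
    have "(d * (2 * (j * m + i)) + 1) mod m = ((d * (2 * i) + 1) + (2 * d * j) * m) mod m" by (simp add: algebra_simps)
    then show "(d * (2 * (j * m + i)) + 1) mod m = (d * (2 * i) + 1) mod m" by simp
  qed
  have p2: "z ^ (d * ((d - 2) * (j * m + i))) = z ^ (d * ((d - 2) * i))"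
  proof (rule power_mod_eq)
    have "(d * ((d - 2) * (j * m + i))) mod m = (d * ((d - 2) * i) + (d * (d - 2) * j) * m) mod m"
      by (simp only: distrib_left distrib_right mult_ac add_ac)
    then show "(d * ((d - 2) * (j * m + i))) mod m = (d * ((d - 2) * i)) mod m" by simp
  qed
  have q: "((base ^ d) ^ e) $ 0 = z ^ (d * e)" for e by (simp add: base_def flip: power_mult)
  have "summand k $ 0 = (1 - z ^ (d * (2 * k) + 1)) * z ^ (d * ((d - 2) * k)) * (ratio k $ 0) ^ (2 * d)" for k
    unfolding summand_def fps_mult_nth_0 numerator_nth_0 q fps_power_zeroth[of "ratio k"] ..
  then show ?thesis using ratio_block[OF assms, of j] p p2 by (simp only: power_mult_distrib mult_ac)
qed

text \<open>Up to the unit \<open>(Q; Q)_s^(2 d)\<close>, these are the summands of \<open>antisymmetric_sum\<close>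
  with \<open>s\<close> in place of \<open>M\<close>.\<close>

lemma partial_block_vanishes: "(\<Sum>i\<le>s. summand i $ 0) = 0"
proof -
  define R where "R = qpochhammer (base ^ d) (base ^ d) s $ 0"
  have R: "R \<noteq> 0" using block_denominator_unit[OF s(1), of 0] by (simp add: R_def qpochhammer_def)
  have q: "((base ^ d) ^ e) $ 0 = (z ^ d) ^ e" for e by (simp add: base_def flip: power_mult)
  have pt: "poly (term_poly base (base ^ d) s i) 1 $ 0 = poly (term_poly z (z ^ d) s i) 1" for i
    by (simp add: poly_term_poly fps_prod_nth0 q) (simp add: base_def)
  have "(\<Sum>i\<le>s. summand i $ 0) * R ^ (2 * d) =
    (\<Sum>i\<le>s. (1 - z * (z ^ d) ^ (2 * i)) * (z ^ d) ^ ((d - 2) * i) * poly (term_poly z (z ^ d) s i) 1 ^ (2 * d))"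
    unfolding sum_distrib_right
  proof (rule sum.cong)
    fix i assume "i \<in> {..s}"
    then have "ratio i $ 0 * R = poly (term_poly z (z ^ d) s i) 1"
      using arg_cong[OF ratio_term_poly[of i], of "\<lambda>f. f $ 0"] by (simp add: R_def pt)
    then have "(ratio i $ 0) ^ (2 * d) * R ^ (2 * d) = poly (term_poly z (z ^ d) s i) 1 ^ (2 * d)"
      by (simp flip: power_mult_distrib)
    then show "summand i $ 0 * R ^ (2 * d) =
        (1 - z * (z ^ d) ^ (2 * i)) * (z ^ d) ^ ((d - 2) * i) * poly (term_poly z (z ^ d) s i) 1 ^ (2 * d)"
      by (simp add: summand_def fps_power_zeroth power_mult_distrib q) (simp add: base_def)
  qed simp
  also have "\<dots> = 0"
  proof (rule antisymmetric_sum)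
    show "z * (z ^ d) ^ s = 1" using s(2) prim[of "d * s + 1"] by (simp add: power_mult)
    show "poly (smult a p) 1 ^ (2 * d) = a ^ (2 * d) * poly p 1 ^ (2 * d)" if "a \<noteq> 0" for a and p :: "complex poly"
      by (simp add: power_mult_distrib)
  qed (use d in simp_all)
  finally show ?thesis using R by simp
qed

text \<open>The summands at \<open>s < i < m\<close> vanish at \<open>t = 0\<close>, so a block cut off anywhere after \<open>s\<close> behaves
  like a complete one.\<close>

lemma block_vanishes:
  assumes "e \<in> {s<..m}" shows "(\<Sum>i<e. summand (j * m + i) $ 0) = 0"
proof -
  have "(\<Sum>i<e. summand i $ 0) = (\<Sum>i\<le>s. summand i $ 0)"
    by (rule sum.mono_neutral_right)
      (use assms d in \<open>auto simp: summand_def fps_power_zeroth ratio_nth_0_eq_0\<close>)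
  moreover have "(\<Sum>i<e. summand (j * m + i) $ 0) = (ratio (j * m) $ 0) ^ (2 * d) * (\<Sum>i<e. summand i $ 0)"
    unfolding sum_distrib_left by (rule sum.cong) (use assms in \<open>auto simp: summand_block\<close>)
  ultimately show ?thesis using partial_block_vanishes by simp
qed

lemma sum_summand_vanishes:
  assumes "e = 0 \<or> e = s + 1"
  shows "fps_X dvd (\<Sum>k<j * m + e. summand k)"
proof -
  have sum_shift: "(\<Sum>k<a + b. summand k) = (\<Sum>k<a. summand k) + (\<Sum>i<b. summand (a + i))" for a b
    by (induction b) (simp_all add: add_ac)
  have full: "(\<Sum>k<j * m. summand k) $ 0 = 0" for j
  proof (induction j)
    case (Suc j)
    have "(\<Sum>k<Suc j * m. summand k) = (\<Sum>k<j * m. summand k) + (\<Sum>i<m. summand (j * m + i))"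
      using sum_shift[of "j * m" m] by (simp add: add.commute)
    then show ?case using Suc block_vanishes[of m j] s(1) by (simp add: fps_sum_nth)
  qed simp
  have "(\<Sum>k<j * m + e. summand k) = (\<Sum>k<j * m. summand k) + (\<Sum>i<e. summand (j * m + i))"
    by (rule sum_shift)
  then have "(\<Sum>k<j * m + e. summand k) $ 0 = 0"
    using assms full[of j] block_vanishes[of "s + 1" j] s(1) by (auto simp: fps_sum_nth)
  then show ?thesis by (simp add: fps_X_dvd_iff')
qed

end

section \<open>Rational functions as power series\<close>

definition localize :: "complex \<Rightarrow> complex poly \<Rightarrow> complex fps" where
  "localize z p = poly (map_poly fps_const p) (local_q z)"

lemma sum_fps_const: "(\<Sum>i\<in>A. fps_const (f i)) = fps_const (\<Sum>i\<in>A. f i)"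
  by (induction A rule: infinite_finite_induct) simp_all

lemma map_poly_fps_const_mult:
  "map_poly fps_const (p * r) = map_poly fps_const p * (map_poly fps_const r :: complex fps poly)"
  by (intro poly_eqI) (simp add: coeff_map_poly coeff_mult sum_fps_const)

lemma localize_mult: "localize z (p * r) = localize z p * localize z r"
  by (simp add: localize_def map_poly_fps_const_mult)

lemma localize_add: "localize z (p + r) = localize z p + localize z r"
proof -
  have "map_poly fps_const (p + r) = map_poly fps_const p + (map_poly fps_const r :: complex fps poly)"
    by (intro poly_eqI) (simp add: coeff_map_poly)
  then show ?thesis by (simp add: localize_def)
qed

lemma localize_const [simp]: "localize z [:c:] = fps_const c"
  by (simp add: localize_def map_poly_pCons)

lemma localize_1 [simp]: "localize z 1 = 1"
  using localize_const[of z 1] by (simp add: one_pCons del: localize_const)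

lemma localize_linear: "localize z [:a, b:] = fps_const a + local_q z * fps_const b"
  by (simp add: localize_def map_poly_pCons)

lemma localize_power: "localize z (p ^ k) = localize z p ^ k"
  by (induction k) (simp_all add: localize_mult)

lemma localize_nth_0: "localize z p $ 0 = poly p z"
proof (induction p)
  case (pCons a p)
  have "localize z (pCons a p) = fps_const a + local_q z * localize z p"
    by (cases "pCons a p = 0") (simp_all add: localize_def map_poly_pCons)
  then show ?case using pCons by simp
qed (simp add: localize_def)

lemma subdegree_localize:
  assumes "z \<noteq> 0" "p \<noteq> 0"
  shows "localize z p \<noteq> 0" "subdegree (localize z p) = order z p"
proof -
  obtain r where r: "p = [:- z, 1:] ^ order z p * r" "\<not> [:- z, 1:] dvd r"
    using order_decomp[OF assms(2)] by blast
  have rz: "localize z r $ 0 \<noteq> 0" using r(2) by (simp add: localize_nth_0 poly_eq_0_iff_dvd)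
  have lin: "localize z [:- z, 1:] $ 0 = 0" "localize z [:- z, 1:] $ 1 = z"
    by (simp_all add: localize_linear local_q_def)
  then have s: "subdegree (localize z [:- z, 1:]) = 1" using assms(1) by (intro subdegreeI) auto
  have nz: "localize z [:- z, 1:] \<noteq> 0" using lin assms(1) by (metis fps_zero_nth)
  have e: "localize z p = localize z [:- z, 1:] ^ order z p * localize z r"
    by (subst r(1)) (simp only: localize_mult localize_power)
  show "localize z p \<noteq> 0" unfolding e using nz rz by auto
  have "subdegree (localize z r) = 0" using rz by (rule subdegree_eq_0)
  moreover have "localize z r \<noteq> 0" using rz by auto
  ultimately show "subdegree (localize z p) = order z p"
    unfolding e using nz s by (simp add: subdegree_power)
qed

text \<open>A rational function \<open>A\<close> that is regular at \<open>z\<close> expands into the power series \<open>y\<close>. The relation is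
  stated by cross-multiplication with an arbitrary representation of \<open>A\<close>, so that a quotient of
  two functions vanishing at \<open>z\<close> can be evaluated as well.\<close>

definition evaluates_to :: "complex \<Rightarrow> rat poly fract \<Rightarrow> complex fps \<Rightarrow> bool" where
  "evaluates_to z A y \<longleftrightarrow> (\<exists>a b. b \<noteq> 0 \<and> A = Fract a b \<and>
     localize z (map_poly of_rat a) = y * localize z (map_poly of_rat b))"

lemma map_poly_of_rat_eq_0_iff: "map_poly of_rat p = (0 :: complex poly) \<longleftrightarrow> p = 0"
  by (simp add: map_poly_eq_0_iff)

lemma map_poly_of_rat_1: "map_poly of_rat 1 = (1 :: complex poly)"
  by (simp add: one_pCons map_poly_pCons)

lemma evaluates_to_Fract: "evaluates_to z (Fract p 1) (localize z (map_poly of_rat p))"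
  unfolding evaluates_to_def by (intro exI[of _ p] exI[of _ 1]) (simp add: map_poly_of_rat_1)

lemma evaluates_to_q: "evaluates_to z q_rat (local_q z)"
  using evaluates_to_Fract[of z q_poly] by (simp add: q_rat_def map_poly_pCons localize_linear)

lemma evaluates_to_0: "evaluates_to z 0 0"
  using evaluates_to_Fract[of z 0] by (simp add: localize_def Zero_fract_def)

lemma evaluates_to_1: "evaluates_to z 1 1"
  using evaluates_to_Fract[of z 1] by (simp add: map_poly_of_rat_1 One_fract_def)

lemma evaluates_to_add:
  assumes "evaluates_to z A x" "evaluates_to z B y"
  shows "evaluates_to z (A + B) (x + y)"
proof -
  obtain a b c e where "b \<noteq> 0" "A = Fract a b" "localize z (map_poly of_rat a) = x * localize z (map_poly of_rat b)"
    "e \<noteq> 0" "B = Fract c e" "localize z (map_poly of_rat c) = y * localize z (map_poly of_rat e)"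
    using assms unfolding evaluates_to_def by blast
  then show ?thesis unfolding evaluates_to_def
    by (intro exI[of _ "a * e + c * b"] exI[of _ "b * e"])
      (simp add: map_poly_of_rat_mult map_poly_of_rat_add localize_mult localize_add algebra_simps)
qed

lemma evaluates_to_mult:
  assumes "evaluates_to z A x" "evaluates_to z B y"
  shows "evaluates_to z (A * B) (x * y)"
proof -
  obtain a b c e where "b \<noteq> 0" "A = Fract a b" "localize z (map_poly of_rat a) = x * localize z (map_poly of_rat b)"
    "e \<noteq> 0" "B = Fract c e" "localize z (map_poly of_rat c) = y * localize z (map_poly of_rat e)"
    using assms unfolding evaluates_to_def by blast
  then show ?thesis unfolding evaluates_to_def
    by (intro exI[of _ "a * c"] exI[of _ "b * e"])
      (simp add: map_poly_of_rat_mult localize_mult algebra_simps)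
qed

lemma evaluates_to_power: "evaluates_to z A x \<Longrightarrow> evaluates_to z (A ^ k) (x ^ k)"
  by (induction k) (simp_all add: evaluates_to_1 evaluates_to_mult)

lemma evaluates_to_sum:
  "(\<And>i. i \<in> I \<Longrightarrow> evaluates_to z (A i) (x i)) \<Longrightarrow> evaluates_to z (sum A I) (sum x I)"
  by (induction I rule: infinite_finite_induct) (simp_all add: evaluates_to_0 evaluates_to_add)

lemma evaluates_to_prod:
  "(\<And>i. i \<in> I \<Longrightarrow> evaluates_to z (A i) (x i)) \<Longrightarrow> evaluates_to z (prod A I) (prod x I)"
  by (induction I rule: infinite_finite_induct) (simp_all add: evaluates_to_1 evaluates_to_mult)

lemma evaluates_to_minus_1: "evaluates_to z (- 1) (- 1)"
proof -
  have "Fract (- 1 :: rat poly) 1 = - 1" by (simp add: One_fract_def)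
  moreover have "map_poly of_rat (- 1) = [:- 1 :: complex:]"
    by (intro poly_eqI) (simp add: coeff_map_poly coeff_pCons one_pCons split: nat.split)
  ultimately show ?thesis using evaluates_to_Fract[of z "- 1"] 
    by (simp add: fps_const_neg[symmetric] del: fps_const_neg)
qed

lemma evaluates_to_diff:
  assumes "evaluates_to z A x" "evaluates_to z B y"
  shows "evaluates_to z (A - B) (x - y)"
  using evaluates_to_add[OF assms(1) evaluates_to_mult[OF evaluates_to_minus_1 assms(2)]] by simp

lemma evaluates_to_divide:
  assumes "z \<noteq> 0" "evaluates_to z A (y * x)" "evaluates_to z B x" "x \<noteq> 0"
  shows "evaluates_to z (A / B) y"
proof -
  obtain a b c e where *: "b \<noteq> 0" "A = Fract a b" "localize z (map_poly of_rat a) = y * x * localize z (map_poly of_rat b)"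
    "e \<noteq> 0" "B = Fract c e" "localize z (map_poly of_rat c) = x * localize z (map_poly of_rat e)"
    using assms unfolding evaluates_to_def by blast
  have "localize z (map_poly of_rat e) \<noteq> 0"
    using assms(1) * by (intro subdegree_localize) (auto simp: map_poly_of_rat_eq_0_iff)
  then have "c \<noteq> 0" using * assms(4) by (auto simp: localize_def)
  then show ?thesis using * unfolding evaluates_to_def
    by (intro exI[of _ "a * e"] exI[of _ "b * c"])
      (simp add: map_poly_of_rat_mult localize_mult algebra_simps)
qed

lemma evaluates_to_qpochhammer:
  "evaluates_to z A x \<Longrightarrow> evaluates_to z B y \<Longrightarrow> evaluates_to z (qpochhammer A B k) (qpochhammer x y k)"
  unfolding qpochhammer_def
  by (intro evaluates_to_prod evaluates_to_diff evaluates_to_mult evaluates_to_power evaluates_to_1)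

lemma evaluates_to_qint: "evaluates_to z A x \<Longrightarrow> evaluates_to z (qint A k) (qint x k)"
  unfolding qint_def by (intro evaluates_to_sum evaluates_to_power)

lemma order_numerator_ge:
  assumes z: "z \<noteq> 0" and A: "A \<noteq> 0" and ev: "evaluates_to z A y" and dvd: "fps_X ^ k dvd y"
  shows "k \<le> order z (map_poly of_rat (fst (quot_of_fract A)))"
proof -
  define u v where "u = fst (quot_of_fract A)" and "v = snd (quot_of_fract A)"
  obtain a b where ab: "b \<noteq> 0" "A = Fract a b" "localize z (map_poly of_rat a) = y * localize z (map_poly of_rat b)"
    using ev unfolding evaluates_to_def by blast
  have v: "v \<noteq> 0" by (simp add: v_def)
  have "Fract u v = A" by (simp add: u_def v_def)
  then have "u * b = a * v" using ab v by (simp add: eq_fract)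
  then have "localize z (map_poly of_rat (u * b)) = localize z (map_poly of_rat (a * v))" by simp
  then have "localize z (map_poly of_rat u) * localize z (map_poly of_rat b) =
     (y * localize z (map_poly of_rat v)) * localize z (map_poly of_rat b)"
    using ab(3) by (simp add: map_poly_of_rat_mult localize_mult mult_ac)
  moreover have "localize z (map_poly of_rat b) \<noteq> 0"
    using z ab(1) by (intro subdegree_localize) (auto simp: map_poly_of_rat_eq_0_iff)
  ultimately have e: "localize z (map_poly of_rat u) = y * localize z (map_poly of_rat v)" by simp
  have u: "map_poly of_rat u \<noteq> (0 :: complex poly)" using A by (simp add: u_def map_poly_of_rat_eq_0_iff)
  have "fps_X ^ k dvd localize z (map_poly of_rat u)" unfolding e using dvd by simp
  then have "k \<le> subdegree (localize z (map_poly of_rat u))"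
    using subdegree_localize(1)[OF z u] by (simp add: fps_dvd_iff)
  then show ?thesis using subdegree_localize(2)[OF z u] by (simp add: u_def)
qed

section \<open>Orders of zeros and divisibility\<close>

lemma dvd_if_order_le:
  fixes p r :: "complex poly"
  assumes "p \<noteq> 0" "r \<noteq> 0" "\<And>x. order x p \<le> order x r"
  shows "p dvd r"
  using assms
proof (induction p arbitrary: r rule: poly_root_order_induct)
  case (no_roots p)
  then have "degree p = 0" using fundamental_theorem_of_algebra constant_degree by blast
  then show ?case using no_roots by (auto simp: is_unit_iff_degree intro: unit_imp_dvd)
next
  case (root p x k)
  then have p: "p \<noteq> 0" by auto
  have "k \<le> order x ([:- x, 1:] ^ k * p)"
    using p by (subst order_mult) (auto simp: order_power_n_n)
  then have "k \<le> order x r" using root.prems(3)[of x] by linarith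
  then obtain r' where r: "r = [:- x, 1:] ^ k * r'"
    using order_divides[of x k r] by (auto elim: dvdE)
  have r': "r' \<noteq> 0" using r root.prems by auto
  have "order y p \<le> order y r'" for y
    using root.prems(3)[of y] p r' unfolding r by (simp add: order_mult)
  then have "p dvd r'" using root.IH[OF p r'] by blast
  then show ?case unfolding r by simp
qed simp

text \<open>Division with remainder over \<open>\<rat>\<close> and over \<open>\<complex>\<close> agree, so a nonzero remainder would survive.\<close>

lemma map_poly_of_rat_dvd_imp:
  assumes "p \<noteq> 0" and "map_poly of_rat p dvd (map_poly of_rat r :: complex poly)"
  shows "p dvd r"
proof (rule ccontr)
  assume n: "\<not> p dvd r"
  define t where "t = r mod p"
  have t: "t \<noteq> 0" "degree t < degree p"
    using n assms(1) degree_mod_less[of p r] by (auto simp: t_def mod_eq_0_iff_dvd)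
  have "map_poly of_rat r = map_poly of_rat (r div p) * map_poly of_rat p + (map_poly of_rat t :: complex poly)"
    unfolding map_poly_of_rat_mult[symmetric] map_poly_of_rat_add[symmetric] by (simp add: t_def)
  then have "map_poly of_rat p dvd (map_poly of_rat t :: complex poly)"
    using assms(2) by (simp add: dvd_add_right_iff)
  then have "degree (map_poly of_rat p :: complex poly) \<le> degree (map_poly of_rat t :: complex poly)"
    by (rule dvd_imp_degree_le) (use t in \<open>simp add: map_poly_of_rat_eq_0_iff\<close>)
  then show False using t by (simp add: degree_map_poly_of_rat)
qed

lemma primitive_order_exists:
  fixes x :: complex
  assumes "x ^ n = 1" "n > 0"
  obtains m where "m > 0" "\<And>i. x ^ i = 1 \<longleftrightarrow> m dvd i"
proof -
  define m where "m = (LEAST i. i > 0 \<and> x ^ i = 1)"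
  have m: "m > 0" "x ^ m = 1"
    using LeastI[of "\<lambda>i. i > 0 \<and> x ^ i = 1" n] assms by (auto simp: m_def)
  have "m dvd i" if "x ^ i = 1" for i
  proof (rule ccontr)
    assume "\<not> m dvd i"
    then have p: "i mod m > 0" by (simp add: dvd_eq_mod_eq_0)
    have "x ^ i = x ^ (m * (i div m) + i mod m)" by simp
    then have "x ^ i = (x ^ m) ^ (i div m) * x ^ (i mod m)" unfolding power_add power_mult .
    then have "x ^ (i mod m) = 1" using that m by simp
    with p have "m \<le> i mod m" unfolding m_def by (intro Least_le conjI)
    then show False using mod_less_divisor[OF m(1), of i] by simp
  qed
  moreover have "x ^ i = 1" if "m dvd i" for i using that m by (auto simp: power_mult elim: dvdE)
  ultimately show thesis using that[OF m(1)] by blast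
qed

lemma cyclotomic_complex_root:
  assumes "n > 0" "poly (cyclotomic_complex n) x = 0"
  shows "x ^ i = 1 \<longleftrightarrow> n dvd i"
proof -
  obtain k where k: "coprime n k" "x = cis (2 * pi / real n) ^ k"
    using assms(2) by (auto simp: cyclotomic_complex_def poly_prod)
  define w where "w = cis (2 * pi / real n)"
  have wn: "w ^ n = 1" using assms(1) by (simp add: w_def DeMoivre)
  have w: "w ^ j = 1 \<longleftrightarrow> n dvd j" for j
  proof
    assume "w ^ j = 1"
    moreover have "w ^ j = w ^ (n * (j div n) + j mod n)" by simp
    then have "w ^ j = (w ^ n) ^ (j div n) * w ^ (j mod n)" unfolding power_add power_mult .
    ultimately have "w ^ (j mod n) = 1" using wn by simp
    then have "cis (2 * pi * real (j mod n) / real n) = cis (2 * pi * real 0 / real n)"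
      by (simp add: w_def DeMoivre mult_ac)
    then have "j mod n = 0"
      by (rule inj_onD[OF bij_betw_imp_inj_on[OF bij_betw_roots_unity[OF assms(1)]]]) (use assms(1) in auto)
    then show "n dvd j" by auto
  next
    assume "n dvd j"
    then obtain l where "j = n * l" by (elim dvdE)
    then show "w ^ j = 1" using wn by (simp add: power_mult)
  qed
  have "x ^ i = w ^ (k * i)" unfolding k(2) w_def power_mult ..
  then show ?thesis using w[of "k * i"] coprime_dvd_mult_right_iff[OF k(1), of i] by simp
qed

lemma monom_minus_1_nonzero:
  assumes "n > 0" shows "monom 1 n - 1 \<noteq> (0 :: complex poly)"
proof
  assume "monom 1 n - 1 = (0 :: complex poly)"
  then have "coeff (monom 1 n - 1) n = (0 :: complex)" by simp
  then show False using assms by simp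
qed

lemma order_power_minus_1_le: 
  assumes n: "n > 0" and x: "x \<noteq> 0"
  shows "order x (monom 1 n - 1 :: complex poly) \<le> 1"
proof -
  have "monom 1 n - 1 = [:0, 1:] ^ n + [:- 1 :: complex:]"
    by (simp add: monom_altdef one_pCons)
  then have "localize x (monom 1 n - 1) = local_q x ^ n + fps_const (- 1)"
    by (simp only: localize_add localize_power localize_const) (simp add: localize_linear)
  then have "localize x (monom 1 n - 1) $ 1 = x ^ n * of_nat n"
    by (simp add: local_q_power)
  then have "subdegree (localize x (monom 1 n - 1)) \<le> 1" using x n by (intro subdegree_leI) simp
  then show ?thesis using subdegree_localize(2)[OF x monom_minus_1_nonzero[OF n]] by simp
qed

lemma order_modulus_le:
  assumes n: "n > 1"
  defines "P \<equiv> map_poly of_rat (qint q_poly n * cyclotomic n ^ 3) :: complex poly"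
  shows "P \<noteq> 0" and "order x P > 0 \<Longrightarrow> x ^ n = 1 \<and> x \<noteq> 1" and
    "order x P \<le> (if (\<forall>i. x ^ i = 1 \<longleftrightarrow> n dvd i) then 4 else 1)"
proof -
  let ?G = "qint [:0, 1:] n :: complex poly" and ?C = "cyclotomic_complex n"
  have "map_poly of_rat (q_poly ^ k) = ([:0, 1:] :: complex poly) ^ k" for k
    by (induction k) (simp_all add: map_poly_of_rat_1 map_poly_of_rat_mult map_poly_pCons del: mult_pCons_left)
  moreover have "map_poly of_rat (\<Sum>i\<in>I. f i) = (\<Sum>i\<in>I. map_poly of_rat (f i) :: complex poly)" for I :: "nat set" and f
    by (induction I rule: infinite_finite_induct) (simp_all add: map_poly_of_rat_add)
  ultimately have G: "map_poly of_rat (qint q_poly n) = ?G" by (simp add: qint_def)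
  have P: "P = ?G * ?C ^ 3"
    using n by (simp add: P_def power3_eq_cube map_poly_of_rat_mult G map_poly_cyclotomic)
  have mon: "monom 1 n - 1 = [:- 1, 1:] * ?G"
  proof -
    have "([:0, 1:] - 1) * ?G = [:0, 1:] ^ n - 1"
      unfolding qint_def by (rule power_diff_1_eq[symmetric])
    moreover have "[:0, 1:] - 1 = [:- 1, 1 :: complex:]" by (simp add: one_pCons)
    ultimately show ?thesis by (simp add: monom_altdef)
  qed
  have C_dvd: "?C dvd monom 1 n - 1"
    using n prod_cyclotomic_complex[of n] dvd_prodI[of "{d. d dvd n}" n cyclotomic_complex] by simp
  have nz: "monom 1 n - 1 \<noteq> (0 :: complex poly)"
    using n by (intro monom_minus_1_nonzero) simp
  have G0: "?G \<noteq> 0" and C0: "?C \<noteq> 0" using nz mon C_dvd by auto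
  then show "P \<noteq> 0" by (simp add: P)
  have root1: "poly P 1 \<noteq> 0"
  proof -
    have "poly ?G 1 = of_nat n" by (simp add: qint_def poly_sum)
    moreover have "poly ?C 1 \<noteq> 0"
      using cyclotomic_complex_root[of n 1 1] n by auto
    ultimately show ?thesis using n by (simp add: P)
  qed
  show root: "x ^ n = 1 \<and> x \<noteq> 1" if "order x P > 0"
  proof -
    have "poly P x = 0" using that \<open>P \<noteq> 0\<close> order_gt_0_iff by blast
    then have "poly ?G x = 0 \<or> poly ?C x = 0" by (simp add: P)
    then have "poly (monom 1 n - 1) x = 0"
    proof
      assume "poly ?G x = 0"
      then show ?thesis unfolding mon poly_mult by (simp only: mult_zero_right)
    next
      assume "poly ?C x = 0"
      moreover obtain r where "monom 1 n - 1 = ?C * r" using C_dvd by (elim dvdE)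
      ultimately show ?thesis by (simp only: poly_mult mult_zero_left)
    qed
    then show ?thesis using root1 \<open>poly P x = 0\<close> by (auto simp: poly_monom)
  qed
  show "order x P \<le> (if (\<forall>i. x ^ i = 1 \<longleftrightarrow> n dvd i) then 4 else 1)"
  proof (cases "order x P = 0")
    case False
    then have "x \<noteq> 0" using root n by (auto simp: power_0_left)
    then have le1: "order x (monom 1 n - 1 :: complex poly) \<le> 1" using order_power_minus_1_le n by simp
    have "?G dvd monom 1 n - 1" unfolding mon by (rule dvd_triv_right)
    then have "order x ?G \<le> order x (monom 1 n - 1)" "order x ?C \<le> order x (monom 1 n - 1)"
      using nz C_dvd by (auto intro: dvd_imp_order_le)
    then have G1: "order x ?G \<le> 1" and C1: "order x ?C \<le> 1" using le1 by auto
    have C2: "order x ?C = 0" if "\<not> (\<forall>i. x ^ i = 1 \<longleftrightarrow> n dvd i)"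
    proof (rule order_0I)
      show "poly ?C x \<noteq> 0" using cyclotomic_complex_root[of n x] n that by auto
    qed
    have "order x P = order x ?G + 3 * order x ?C"
      unfolding P using G0 C0 by (simp add: order_mult power3_eq_cube)
    then show ?thesis using G1 C1 C2 by auto
  qed simp
qed

section \<open>The congruence\<close>

context full_order_root
begin

sublocale root_block z n d M
proof
  show "n > 1" using n d r by (cases r) auto
  show "d \<ge> 2" using d by simp
  show "n dvd d * M + 1" unfolding dM by simp
qed (fact prim coprime_nd M_less)+

text \<open>Passing from \<open>M\<close> to \<open>n - 1\<close> adds summands that contain the \<open>2 d\<close>-th power of a factor
  vanishing at \<open>t = 0\<close>.\<close>

lemma fourth_order_summands:
  assumes N: "N = (d - 1) * r \<or> N = n"
  shows "fps_X ^ 4 dvd (\<Sum>k<N. summand k)"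
proof -
  have "(d - 1) * r > 0" using d r by simp
  then have M1: "Suc M = (d - 1) * r" by (simp add: M)
  define R where "R = qpochhammer (base ^ d) (base ^ d) M"
  have R: "is_unit (R ^ (2 * d))"
    using block_denominator_unit[OF M_less, of 0]
    by (simp add: fps_is_unit_iff R_def qpochhammer_def fps_power_zeroth)
  have "(\<Sum>k\<le>M. (1 - local_q z * (local_q z ^ d) ^ (2 * k)) * (local_q z ^ d) ^ ((d - 2) * k) *
      poly (term_poly (local_q z) (local_q z ^ d) M k) 1 ^ (2 * d)) = (\<Sum>k\<le>M. summand k) * R ^ (2 * d)"
    unfolding sum_distrib_right
  proof (rule sum.cong)
    fix k assume "k \<in> {..M}"
    then have "ratio k * R = poly (term_poly (local_q z) (local_q z ^ d) M k) 1"
      using ratio_term_poly[of k] by (simp add: R_def base_def)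
    then show "(1 - local_q z * (local_q z ^ d) ^ (2 * k)) * (local_q z ^ d) ^ ((d - 2) * k) *
      poly (term_poly (local_q z) (local_q z ^ d) M k) 1 ^ (2 * d) = summand k * R ^ (2 * d)"
      by (simp only: summand_def base_def power_mult_distrib[symmetric] mult.assoc)
  qed simp
  then have "fps_X ^ 4 dvd (\<Sum>k\<le>M. summand k) * R ^ (2 * d)"
    using fourth_order_vanishing by simp
  then have main: "fps_X ^ 4 dvd (\<Sum>k<Suc M. summand k)"
    using R by (simp add: dvd_mult_unit_iff lessThan_Suc_atMost)
  show ?thesis
  proof (cases "N = (d - 1) * r")
    case False
    have high: "fps_X ^ 4 dvd summand k" if "k \<in> {Suc M..<n}" for k
    proof -
      have "fps_X dvd ratio k"
        using ratio_nth_0_eq_0[of k] that by (simp add: fps_X_dvd_iff')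
      then have "fps_X ^ (2 * d) dvd ratio k ^ (2 * d)" by (rule dvd_power_same)
      moreover have "fps_X ^ 4 dvd (fps_X ^ (2 * d) :: complex fps)" using d by (intro le_imp_power_dvd) simp
      ultimately show ?thesis unfolding summand_def by (intro dvd_mult) (rule dvd_trans)
    qed
    have "{..<n} = {..<Suc M} \<union> {Suc M..<n}" using M_less by auto
    then have "(\<Sum>k<n. summand k) = (\<Sum>k<Suc M. summand k) + (\<Sum>k\<in>{Suc M..<n}. summand k)"
      by (simp only: sum.union_disjoint[OF finite_lessThan finite_atLeastLessThan] ivl_disj_int)
    moreover have "N = n" using False N by simp
    ultimately show ?thesis using main high by (simp only: dvd_add dvd_sum)
  qed (use main M1 in simp)
qed

end

theorem mainTheorem2:
  fixes d n M :: nat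
  assumes "d \<ge> 3" and "n > 0" and "[int n = - 1] (mod int d)"
    and "M = ((d - 1) * n - 1) div d \<or> M = n - 1"
  shows "ratfun_cong
           (\<Sum>k=0..M. qint q_rat (2 * d * k + 1)
              * (qpochhammer q_rat (q_rat ^ d) k ^ (2 * d)
                 / qpochhammer (q_rat ^ d) (q_rat ^ d) k ^ (2 * d))
              * q_rat ^ (d * (d - 2) * k))
           0
           (qint q_poly n * cyclotomic n ^ 3)"
proof -
  define A where "A = (\<Sum>k=0..M. qint q_rat (2 * d * k + 1)
              * (qpochhammer q_rat (q_rat ^ d) k ^ (2 * d)
                 / qpochhammer (q_rat ^ d) (q_rat ^ d) k ^ (2 * d))
              * q_rat ^ (d * (d - 2) * k))"
  define P :: "complex poly" where "P = map_poly of_rat (qint q_poly n * cyclotomic n ^ 3)"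
  have d: "d \<ge> 3" "d \<ge> 2" using assms(1) by auto
  have "int d dvd int (n + 1)" using assms(3) by (simp add: cong_iff_dvd_diff add.commute)
  then have "d dvd n + 1" unfolding int_dvd_int_iff .
  then obtain r where n: "n + 1 = d * r" by (elim dvdE)
  have r: "r > 0" using n by (cases r) auto
  have n1: "n > 1" using n d r by (cases r) auto
  define M' where "M' = (d - 1) * r - 1"
  have "(d - 1) * r > 0" using d r by simp
  then have M'1: "M' + 1 = (d - 1) * r" by (simp add: M'_def)
  have dM': "d * M' + 1 = (d - 1) * n"
    unfolding M'_def using d(2) r n by (rule terminating_index)
  have "((d - 1) * n - 1) div d = M'" using dM'[symmetric] d by simp
  then have M: "M + 1 = (d - 1) * r \<or> M + 1 = n" using assms(4) M'1 n1 by auto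
  have cop: "coprime n d" using n by (rule coprime_if_Suc_eq_mult)
  have local: "order x P \<le> order x (map_poly of_rat (fst (quot_of_fract A)))" if A: "A \<noteq> 0" for x
  proof (cases "order x P = 0")
    case False
    then have x: "x ^ n = 1" "x \<noteq> 1" using order_modulus_le(2)[OF n1, of x] by (auto simp: P_def)
    then have x0: "x \<noteq> 0" using n1 by (auto simp: power_0_left)
    obtain m where m: "m > 0" "\<And>i. x ^ i = 1 \<longleftrightarrow> m dvd i"
      using primitive_order_exists[OF x(1) assms(2)] by blast
    have m1: "m > 1" using m(1) m(2)[of 1] x(2) by (cases "m = 1") auto
    have mn: "m dvd n" using m(2)[of n] x(1) by simp
    have copm: "coprime m d" using cop mn by (rule coprime_divisors[OF _ dvd_refl, rotated 1])
    \<comment> \<open>\<open>d M' + 1\<close> is divisible by \<open>n\<close>, hence by \<open>m\<close>, so \<open>s\<close> is the first zero of the numerator.\<close>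
    define s where "s = M' mod m"
    have s: "s < m" using m(1) by (simp add: s_def)
    have s2: "m dvd d * s + 1"
    proof -
      have "m dvd d * M' + 1" unfolding dM' using mn by simp
      also have "d * M' + 1 = m * (d * (M' div m)) + (d * s + 1)"
        using mult_div_mod_eq[of m M'] unfolding s_def by (metis add.assoc distrib_left mult.left_commute)
      finally show ?thesis by (simp only: dvd_add_right_iff[OF dvd_triv_left])
    qed
    interpret block: root_block x m d s by unfold_locales (fact m(2) m1 d(2) copm s s2)+
    define Y where "Y = (\<Sum>k=0..M. qint (local_q x) (2 * d * k + 1) * block.ratio k ^ (2 * d) * local_q x ^ (d * (d - 2) * k))"
    have ev: "evaluates_to x A Y"
      unfolding A_def Y_def
    proof (intro evaluates_to_sum evaluates_to_mult evaluates_to_qint evaluates_to_power evaluates_to_q)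
      fix k
      have "block.ratio k ^ (2 * d) * qpochhammer (local_q x ^ d) (local_q x ^ d) k ^ (2 * d) =
          qpochhammer (local_q x) (local_q x ^ d) k ^ (2 * d)"
        using block.ratio_mult[of k] by (simp add: block.base_def flip: power_mult_distrib)
      then have "evaluates_to x (qpochhammer q_rat (q_rat ^ d) k ^ (2 * d))
          (block.ratio k ^ (2 * d) * qpochhammer (local_q x ^ d) (local_q x ^ d) k ^ (2 * d))"
        by (simp only:) (intro evaluates_to_power evaluates_to_qpochhammer evaluates_to_q)
      then show "evaluates_to x (qpochhammer q_rat (q_rat ^ d) k ^ (2 * d) / qpochhammer (q_rat ^ d) (q_rat ^ d) k ^ (2 * d))
          (block.ratio k ^ (2 * d))"
        by (rule evaluates_to_divide[OF x0])
          (use block.qpochhammer_nonzero[of k] in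
            \<open>auto intro!: evaluates_to_power evaluates_to_qpochhammer evaluates_to_q simp: block.base_def\<close>)
    qed
    have Y: "(1 - local_q x) * Y = (\<Sum>k<M + 1. block.summand k)"
    proof -
      have qint: "(1 - local_q x) * qint (local_q x) (2 * d * k + 1) = 1 - local_q x * (local_q x ^ d) ^ (2 * k)" for k
      proof -
        have "(1 - local_q x) * qint (local_q x) (2 * d * k + 1) = 1 - local_q x ^ (2 * d * k + 1)"
          unfolding qint_def by (rule one_diff_power_eq[symmetric])
        also have "local_q x ^ (2 * d * k + 1) = local_q x * (local_q x ^ d) ^ (2 * k)"
          by (simp add: mult_ac flip: power_mult)
        finally show ?thesis .
      qed
      have pow: "local_q x ^ (d * (d - 2) * k) = (local_q x ^ d) ^ ((d - 2) * k)" for k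
        by (simp add: mult_ac flip: power_mult)
      have "(1 - local_q x) * (qint (local_q x) (2 * d * k + 1) * block.ratio k ^ (2 * d) * local_q x ^ (d * (d - 2) * k))
         = ((1 - local_q x) * qint (local_q x) (2 * d * k + 1)) * local_q x ^ (d * (d - 2) * k) * block.ratio k ^ (2 * d)" for k
        by (simp only: mult_ac)
      then have "(1 - local_q x) * (qint (local_q x) (2 * d * k + 1) * block.ratio k ^ (2 * d) * local_q x ^ (d * (d - 2) * k))
         = block.summand k" for k
        unfolding block.summand_def block.base_def qint pow .
      then have "(1 - local_q x) * Y = (\<Sum>k=0..M. block.summand k)"
        unfolding Y_def sum_distrib_left by simp
      also have "{0..M} = {..<M + 1}" by auto
      finally show ?thesis .
    qed
    have unit: "is_unit (1 - local_q x)" using x(2) by (simp add: fps_is_unit_iff)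
    show ?thesis
    proof (cases "m = n")
      case True
      interpret full: full_order_root x n d r M'
        by unfold_locales (use m(2) True d r n M'_def in auto)
      have "fps_X ^ 4 dvd (1 - local_q x) * Y"
        unfolding Y by (rule full.fourth_order_summands[OF M])
      then have "fps_X ^ 4 dvd Y" using unit by (simp add: dvd_mult_unit_iff')
      then have "4 \<le> order x (map_poly of_rat (fst (quot_of_fract A)))"
        by (rule order_numerator_ge[OF x0 A ev])
      then show ?thesis using order_modulus_le(3)[OF n1, of x] by (auto simp: P_def split: if_splits)
    next
      case False
      \<comment> \<open>Both upper limits end a block or cut it off right after its \<open>s\<close>-th term.\<close>
      obtain j e where je: "M + 1 = j * m + e" "e = 0 \<or> e = s + 1"
      proof (cases "M + 1 = n")
        case True
        then show ?thesis using that[of "n div m" 0] mn by simp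
      next
        case False
        then have "M + 1 = M' div m * m + (s + 1)" using M M'1 by (simp add: s_def)
        then show ?thesis using that by blast
      qed
      have "fps_X dvd (1 - local_q x) * Y"
        unfolding Y je(1) by (rule block.sum_summand_vanishes[OF je(2)])
      then have "fps_X ^ 1 dvd Y" using unit by (simp add: dvd_mult_unit_iff')
      then have "1 \<le> order x (map_poly of_rat (fst (quot_of_fract A)))"
        by (rule order_numerator_ge[OF x0 A ev])
      moreover have "order x P \<le> 1"
        unfolding P_def
      proof (rule order.trans[OF order_modulus_le(3)[OF n1]])
        have "\<not> (\<forall>i. x ^ i = 1 \<longleftrightarrow> n dvd i)"
        proof
          assume "\<forall>i. x ^ i = 1 \<longleftrightarrow> n dvd i"
          then have "n dvd m" using m(2)[of m] by simp
          then show False using mn False by (simp add: dvd_antisym)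
        qed
        then show "(if \<forall>i. x ^ i = 1 \<longleftrightarrow> n dvd i then 4 else 1) \<le> (1 :: nat)" by (simp only: if_False)
      qed
      ultimately show ?thesis by linarith
    qed
  qed simp
  have "qint q_poly n * cyclotomic n ^ 3 dvd fst (quot_of_fract A)"
  proof (cases "A = 0")
    case False
    have P0: "P \<noteq> (0 :: complex poly)" using order_modulus_le(1)[OF n1] by (simp add: P_def)
    have "P dvd map_poly of_rat (fst (quot_of_fract A))"
      by (rule dvd_if_order_le[OF P0]) (use False local in \<open>simp_all add: map_poly_of_rat_eq_0_iff\<close>)
    moreover have "qint q_poly n * cyclotomic n ^ 3 \<noteq> 0" using P0 by (auto simp: P_def)
    ultimately show ?thesis unfolding P_def by (intro map_poly_of_rat_dvd_imp)
  qed simp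
  then show ?thesis by (simp add: ratfun_cong_def A_def)
qed

end
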